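(* Let $\mathcal{C}$ be an abelian category with enough injective objects. Let $(M^{k},\tau^{k}:M^{k}\to M^{k+1})_{k\geq 0}$ be a cochain complex in $\mathcal{C}$ whose cohomology vanishes in all degrees $k\ge 1$, and let $M=\ker(\tau^{0})$ be its only (possibly) nontrivial cohomology. For each integer $k\geq 0$ let $(I^{k,t},\partial^{k,t}:I^{k,t}\to I^{k,t+1})_{t\geq 0}$ be an injective resolution of $M^{k}$. Then there exist morphisms $$\partial^{k,t}_{i}:I^{k,t}\to I^{k+i+1,t-i}\qquad (k,t\ge 0,\ 0\le i\le t)$$ such that the morphisms $$\partial^{l}:\bigoplus_{m+n=l}I^{m,n}\longrightarrow \bigoplus_{m+n=l+1}I^{m,n}\qquad (l\ge 0),$$ whose component $I^{m,n}\to I^{m',n'}$ (with $m+n=l$, $m'+n'=l+1$) is $\partial^{m,n}$ if $m'=m$, is $\partial^{m,n}_{i}$ if $m'=m+i+1$ with $0\le i\le n$, and is $0$ if $m'<m$, make $$I^{0,0}\xrightarrow{\partial^{0}} I^{0,1}\oplus I^{1,0}\xrightarrow{\partial^{1}}\cdots\xrightarrow{\partial^{l}}\bigoplus_{m+n=l+1}I^{m,n}\xrightarrow{\partial^{l+1}}\cdots$$ a cochain complex which is an injective resolution of $M$.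
   Context: All indices $k,t,m,n,l$ are nonnegative integers. An injective resolution of an object $X$ is a cochain complex of injective objects in degrees $\ge 0$ whose cohomology is $X$ in degree $0$ and zero in other degrees. *)

theory Defs
  imports "HOL-Algebra.FiniteProduct"
begin

section \<open>Categories\<close>

text \<open>
  Arrows carry their domain and codomain, so hom-sets are pairwise disjoint.  Composition is
  written in the usual order: \<open>g \<cdot> f\<close> is \<open>g\<close> after \<open>f\<close>, and is meaningful only for
  \<open>Dom g = Cod f\<close>.
\<close>

record ('o, 'm) category =
  Obj :: "'o set"
  Arr :: "'m set"
  Dom :: "'m \<Rightarrow> 'o"
  Cod :: "'m \<Rightarrow> 'o"
  Ide :: "'o \<Rightarrow> 'm"
  Comp :: "'m \<Rightarrow> 'm \<Rightarrow> 'm"  (infixl "\<cdot>\<index>" 70)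

definition Hom :: "('o, 'm, 'r) category_scheme \<Rightarrow> 'o \<Rightarrow> 'o \<Rightarrow> 'm set" where
  "Hom C X Y = {f \<in> Arr C. Dom C f = X \<and> Cod C f = Y}"

locale category =
  fixes C :: "('o, 'm, 'r) category_scheme" (structure)
  assumes Dom_in_Obj: "f \<in> Arr C \<Longrightarrow> Dom C f \<in> Obj C"
    and Cod_in_Obj: "f \<in> Arr C \<Longrightarrow> Cod C f \<in> Obj C"
    and Ide_in_Hom: "X \<in> Obj C \<Longrightarrow> Ide C X \<in> Hom C X X"
    and Comp_in_Hom: "f \<in> Hom C X Y \<Longrightarrow> g \<in> Hom C Y Z \<Longrightarrow> g \<cdot> f \<in> Hom C X Z"
    and Comp_Ide_right: "f \<in> Hom C X Y \<Longrightarrow> f \<cdot> Ide C X = f"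
    and Comp_Ide_left: "f \<in> Hom C X Y \<Longrightarrow> Ide C Y \<cdot> f = f"
    and Comp_assoc: "f \<in> Hom C W X \<Longrightarrow> g \<in> Hom C X Y \<Longrightarrow> h \<in> Hom C Y Z \<Longrightarrow>
          h \<cdot> g \<cdot> f = h \<cdot> (g \<cdot> f)"

definition is_mono :: "('o, 'm, 'r) category_scheme \<Rightarrow> 'm \<Rightarrow> bool" where
  "is_mono C f \<longleftrightarrow> f \<in> Arr C \<and>
     (\<forall>W. \<forall>g \<in> Hom C W (Dom C f). \<forall>h \<in> Hom C W (Dom C f).
        f \<cdot>\<^bsub>C\<^esub> g = f \<cdot>\<^bsub>C\<^esub> h \<longrightarrow> g = h)"

definition is_epi :: "('o, 'm, 'r) category_scheme \<Rightarrow> 'm \<Rightarrow> bool" where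
  "is_epi C f \<longleftrightarrow> f \<in> Arr C \<and>
     (\<forall>W. \<forall>g \<in> Hom C (Cod C f) W. \<forall>h \<in> Hom C (Cod C f) W.
        g \<cdot>\<^bsub>C\<^esub> f = h \<cdot>\<^bsub>C\<^esub> f \<longrightarrow> g = h)"

definition is_zero_object :: "('o, 'm, 'r) category_scheme \<Rightarrow> 'o \<Rightarrow> bool" where
  "is_zero_object C Z \<longleftrightarrow> Z \<in> Obj C \<and>
     (\<forall>X \<in> Obj C. (\<exists>!f. f \<in> Hom C X Z) \<and> (\<exists>!f. f \<in> Hom C Z X))"

definition is_injective :: "('o, 'm, 'r) category_scheme \<Rightarrow> 'o \<Rightarrow> bool" where
  "is_injective C J \<longleftrightarrow> J \<in> Obj C \<and>
     (\<forall>X Y. \<forall>f \<in> Hom C X Y. \<forall>g \<in> Hom C X J.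
        is_mono C f \<longrightarrow> (\<exists>h \<in> Hom C Y J. h \<cdot>\<^bsub>C\<^esub> f = g))"

definition enough_injectives :: "('o, 'm, 'r) category_scheme \<Rightarrow> bool" where
  "enough_injectives C \<longleftrightarrow>
     (\<forall>X \<in> Obj C. \<exists>J. is_injective C J \<and> (\<exists>f \<in> Hom C X J. is_mono C f))"


section \<open>Abelian categories\<close>

record ('o, 'm) preadditive_category = "('o, 'm) category" +
  Add :: "'m \<Rightarrow> 'm \<Rightarrow> 'm"  (infixl "\<boxplus>\<index>" 65)
  Zero :: "'o \<Rightarrow> 'o \<Rightarrow> 'm"

text \<open>The group of arrows \<open>X \<rightarrow> Y\<close>; its operation is \<open>Add\<close>, so \<open>finprod\<close> in it is a finite sum.\<close>

definition Hom_group ::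
    "('o, 'm, 'r) preadditive_category_scheme \<Rightarrow> 'o \<Rightarrow> 'o \<Rightarrow> 'm monoid" where
  "Hom_group C X Y = \<lparr>carrier = Hom C X Y, monoid.mult = Add C, one = Zero C X Y\<rparr>"

locale preadditive_category = category C
  for C :: "('o, 'm, 'r) preadditive_category_scheme" (structure) +
  assumes comm_group_Hom: "X \<in> Obj C \<Longrightarrow> Y \<in> Obj C \<Longrightarrow> comm_group (Hom_group C X Y)"
    and Comp_Add_right: "f \<in> Hom C X Y \<Longrightarrow> f' \<in> Hom C X Y \<Longrightarrow> g \<in> Hom C Y Z \<Longrightarrow>
          g \<cdot> (f \<boxplus> f') = g \<cdot> f \<boxplus> g \<cdot> f'"
    and Comp_Add_left: "f \<in> Hom C X Y \<Longrightarrow> g \<in> Hom C Y Z \<Longrightarrow> g' \<in> Hom C Y Z \<Longrightarrow>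
          (g \<boxplus> g') \<cdot> f = g \<cdot> f \<boxplus> g' \<cdot> f"

definition is_kernel ::
    "('o, 'm, 'r) preadditive_category_scheme \<Rightarrow> 'm \<Rightarrow> 'o \<Rightarrow> 'm \<Rightarrow> bool" where
  "is_kernel C f K \<kappa> \<longleftrightarrow> f \<in> Arr C \<and> \<kappa> \<in> Hom C K (Dom C f) \<and>
     f \<cdot>\<^bsub>C\<^esub> \<kappa> = Zero C K (Cod C f) \<and>
     (\<forall>W. \<forall>g \<in> Hom C W (Dom C f). f \<cdot>\<^bsub>C\<^esub> g = Zero C W (Cod C f) \<longrightarrow>
        (\<exists>!u. u \<in> Hom C W K \<and> \<kappa> \<cdot>\<^bsub>C\<^esub> u = g))"

definition is_cokernel ::
    "('o, 'm, 'r) preadditive_category_scheme \<Rightarrow> 'm \<Rightarrow> 'o \<Rightarrow> 'm \<Rightarrow> bool" where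
  "is_cokernel C f Q q \<longleftrightarrow> f \<in> Arr C \<and> q \<in> Hom C (Cod C f) Q \<and>
     q \<cdot>\<^bsub>C\<^esub> f = Zero C (Dom C f) Q \<and>
     (\<forall>W. \<forall>g \<in> Hom C (Cod C f) W. g \<cdot>\<^bsub>C\<^esub> f = Zero C (Dom C f) W \<longrightarrow>
        (\<exists>!u. u \<in> Hom C Q W \<and> u \<cdot>\<^bsub>C\<^esub> q = g))"

text \<open>Direct sums (biproducts) of a finite family; the empty one is a zero object.\<close>

definition is_direct_sum ::
    "('o, 'm, 'r) preadditive_category_scheme \<Rightarrow> 'i set \<Rightarrow> ('i \<Rightarrow> 'o) \<Rightarrow>
     'o \<Rightarrow> ('i \<Rightarrow> 'm) \<Rightarrow> ('i \<Rightarrow> 'm) \<Rightarrow> bool" where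
  "is_direct_sum C J X S \<iota> \<pi> \<longleftrightarrow> finite J \<and> S \<in> Obj C \<and>
     (\<forall>j \<in> J. \<iota> j \<in> Hom C (X j) S \<and> \<pi> j \<in> Hom C S (X j)) \<and>
     (\<forall>i \<in> J. \<forall>j \<in> J.
        \<pi> j \<cdot>\<^bsub>C\<^esub> \<iota> i = (if i = j then Ide C (X i) else Zero C (X i) (X j))) \<and>
     finprod (Hom_group C S S) (\<lambda>j. \<iota> j \<cdot>\<^bsub>C\<^esub> \<pi> j) J = Ide C S"

locale abelian_category = preadditive_category C
  for C :: "('o, 'm, 'r) preadditive_category_scheme" (structure) +
  assumes finite_direct_sums: "(\<And>i. i < n \<Longrightarrow> X i \<in> Obj C) \<Longrightarrow>
          \<exists>S \<iota> \<pi>. is_direct_sum C {..<n::nat} X S \<iota> \<pi>"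
    and has_kernels: "f \<in> Arr C \<Longrightarrow> \<exists>K \<kappa>. is_kernel C f K \<kappa>"
    and has_cokernels: "f \<in> Arr C \<Longrightarrow> \<exists>Q q. is_cokernel C f Q q"
    and mono_is_kernel: "is_mono C f \<Longrightarrow> \<exists>g. is_kernel C g (Dom C f) f"
    and epi_is_cokernel: "is_epi C f \<Longrightarrow> \<exists>g. is_cokernel C g (Cod C f) f"


text \<open>
  The axiom on finite direct sums covers families indexed by an initial segment of the natural
  numbers; hence every finite family has a direct sum.
\<close>

lemma (in abelian_category) direct_sum_exists:
  assumes "finite J" and X: "\<And>j. j \<in> J \<Longrightarrow> X j \<in> Obj C"
  shows "\<exists>S \<iota> \<pi>. is_direct_sum C J X S \<iota> \<pi>"
proof -
  obtain h where h: "bij_betw h J {..<card J}"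
    using ex_bij_betw_finite_nat[OF \<open>finite J\<close>] by (auto simp: atLeast0LessThan)
  define g where "g = inv_into J h"
  have g: "bij_betw g {..<card J} J"
    unfolding g_def by (rule bij_betw_inv_into[OF h])
  have gh: "g (h j) = j" if "j \<in> J" for j
    using h that by (auto simp: g_def bij_betw_def)
  have hJ: "h j < card J" if "j \<in> J" for j
    using h that by (auto simp: bij_betw_def)
  have hinj: "h i = h j \<longleftrightarrow> i = j" if "i \<in> J" "j \<in> J" for i j
    using h that by (auto simp: bij_betw_def inj_on_def)
  have "X (g i) \<in> Obj C" if "i < card J" for i
    using g that X by (auto simp: bij_betw_def)
  then obtain S \<iota> \<pi> where S: "is_direct_sum C {..<card J} (\<lambda>i. X (g i)) S \<iota> \<pi>"
    using finite_direct_sums[of "card J" "\<lambda>i. X (g i)"] by blast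
  then have SO: "S \<in> Obj C"
    by (simp add: is_direct_sum_def)
  interpret G: comm_group "Hom_group C S S"
    by (rule comm_group_Hom[OF SO SO])
  have img: "h ` J = {..<card J}" and inj: "inj_on h J"
    using h by (auto simp: bij_betw_def)
  have "finprod (Hom_group C S S) (\<lambda>i. \<iota> i \<cdot> \<pi> i) (h ` J) =
      finprod (Hom_group C S S) (\<lambda>j. \<iota> (h j) \<cdot> \<pi> (h j)) J"
    using S inj unfolding img[symmetric]
    by (intro G.finprod_reindex) (auto simp: is_direct_sum_def Hom_group_def intro!: Comp_in_Hom)
  moreover have "\<iota> (h j) \<in> Hom C (X j) S \<and> \<pi> (h j) \<in> Hom C S (X j)" if "j \<in> J" for j
    using S hJ[OF that] gh[OF that] unfolding is_direct_sum_def by (metis lessThan_iff)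
  ultimately have "is_direct_sum C J X S (\<lambda>j. \<iota> (h j)) (\<lambda>j. \<pi> (h j))"
    using S \<open>finite J\<close> unfolding is_direct_sum_def img by (simp add: hJ gh hinj)
  then show ?thesis by blast
qed


section \<open>Cochain complexes and injective resolutions\<close>

text \<open>All complexes live in degrees \<open>\<ge> 0\<close>.\<close>

definition cochain_complex ::
    "('o, 'm, 'r) preadditive_category_scheme \<Rightarrow> (nat \<Rightarrow> 'o) \<Rightarrow> (nat \<Rightarrow> 'm) \<Rightarrow> bool" where
  "cochain_complex C X d \<longleftrightarrow>
     (\<forall>k. d k \<in> Hom C (X k) (X (Suc k))) \<and>
     (\<forall>k. d (Suc k) \<cdot>\<^bsub>C\<^esub> d k = Zero C (X k) (X (Suc (Suc k))))"

text \<open>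
  \<open>is_cohomology C X d k H\<close>: the object \<open>H\<close> is a degree \<open>k\<close> cohomology object of the complex.
  In degree \<open>k + 1\<close> it is a cokernel of the arrow \<open>u\<close> from \<open>X k\<close> to the kernel of \<open>d (k + 1)\<close>
  through which \<open>d k\<close> factors; in degree 0 the incoming differential is zero, and the
  cohomology is the kernel of \<open>d 0\<close>.  Such an \<open>H\<close> is determined up to isomorphism only.
\<close>

fun is_cohomology ::
    "('o, 'm, 'r) preadditive_category_scheme \<Rightarrow> (nat \<Rightarrow> 'o) \<Rightarrow> (nat \<Rightarrow> 'm) \<Rightarrow>
     nat \<Rightarrow> 'o \<Rightarrow> bool" where
  "is_cohomology C X d 0 H \<longleftrightarrow> (\<exists>\<kappa>. is_kernel C (d 0) H \<kappa>)"
| "is_cohomology C X d (Suc k) H \<longleftrightarrow>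
     (\<exists>K \<kappa> u q. is_kernel C (d (Suc k)) K \<kappa> \<and> u \<in> Hom C (X k) K \<and>
        \<kappa> \<cdot>\<^bsub>C\<^esub> u = d k \<and> is_cokernel C u H q)"

definition cohomology_vanishes ::
    "('o, 'm, 'r) preadditive_category_scheme \<Rightarrow> (nat \<Rightarrow> 'o) \<Rightarrow> (nat \<Rightarrow> 'm) \<Rightarrow> nat \<Rightarrow> bool" where
  "cohomology_vanishes C X d k \<longleftrightarrow> (\<exists>Z. is_zero_object C Z \<and> is_cohomology C X d k Z)"

definition injective_resolution ::
    "('o, 'm, 'r) preadditive_category_scheme \<Rightarrow> 'o \<Rightarrow> (nat \<Rightarrow> 'o) \<Rightarrow> (nat \<Rightarrow> 'm) \<Rightarrow> bool" where
  "injective_resolution C A J d \<longleftrightarrow>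
     cochain_complex C J d \<and> (\<forall>k. is_injective C (J k)) \<and>
     is_cohomology C J d 0 A \<and> (\<forall>k \<ge> 1. cohomology_vanishes C J d k)"


section \<open>The total differential\<close>

text \<open>The component from the summand \<open>(m, n)\<close> to the summand \<open>(m', n')\<close>.  If \<open>m' = m + i + 1\<close>
  and \<open>m' + n' = m + n + 1\<close> then \<open>n' = n - i\<close>, so that \<open>i \<le> n\<close> holds automatically.\<close>

definition total_component ::
    "('o, 'm, 'r) preadditive_category_scheme \<Rightarrow> (nat \<Rightarrow> nat \<Rightarrow> 'o) \<Rightarrow> (nat \<Rightarrow> nat \<Rightarrow> 'm) \<Rightarrow>
     (nat \<Rightarrow> nat \<Rightarrow> nat \<Rightarrow> 'm) \<Rightarrow> nat \<times> nat \<Rightarrow> nat \<times> nat \<Rightarrow> 'm" where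
  "total_component C I \<delta> E = (\<lambda>(m, n) (m', n').
     if m' = m then \<delta> m n
     else if m < m' then E m n (m' - m - 1)
     else Zero C (I m n) (I m' n'))"

end

theory Submission imports Defs begin

text \<open>
  The proof has two ingredients.  First, in an abelian category with enough injectives a complex
  \<open>X \<rightarrow> Y \<rightarrow> Z\<close> is exact at \<open>Y\<close> if and only if every arrow from \<open>Y\<close> to an injective object that
  kills the image of \<open>X\<close> extends over \<open>Z\<close> (\<open>hom_exact\<close>; the two directions are
  \<open>vanishing_imp_hom_exact\<close> and \<open>hom_exact_imp_vanishing\<close>).  Exactness thereby becomes an
  extension property for arrows into injectives, and this is at once what a construction of the
  arrows \<open>\<partial>\<^sub>i\<close>, whose targets are injective, can use and what a proof that the total complex is
  acyclic has to establish.

  Second, place \<open>M\<^sup>m\<close> below its resolution, so that column \<open>m\<close> is the exact complex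
  \<open>M\<^sup>m \<rightarrow> I\<^sup>m\<^sup>,\<^sup>0 \<rightarrow> I\<^sup>m\<^sup>,\<^sup>1 \<rightarrow> \<dots>\<close>, and look for a differential on the total complex of this augmented
  array that preserves the filtration by columns and whose associated graded
  differential is that of the columns.  As the columns are exact, an arrow from the total complex to
  an injective object that kills the incoming differential can be extended along the outgoing one,
  one column at a time; each column needs a single correction, and the extension vanishes on the
  columns on which the given arrow vanishes.  This is \<open>filtered_exact\<close>.
  The lemma builds the differential by recursion on the degree: a row of the next differential,
  with injective target \<open>I\<^sup>m\<^sup>,\<^sup>n\<close>, is the vertical differential plus a correction supported on the
  columns before \<open>m\<close>, and \<open>filtered_exact\<close> supplies the correction that makes the
  square vanish (\<open>row_into_injective\<close>).  The row with target \<open>M\<^sup>m\<close> is simply \<open>\<tau>\<close>.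

  The summands \<open>I\<^sup>m\<^sup>,\<^sup>n\<close> form a subcomplex of the augmented total complex, with quotient the shifted
  complex \<open>M\<close>.  The augmented total complex is exact, again by \<open>filtered_exact\<close>, so
  the subcomplex has the cohomology of \<open>M\<close>.  In terms of arrows into an injective \<open>Q\<close>: an arrow
  from the subcomplex extends to the augmented complex, compatibly with the differentials, by
  solving one extension problem along \<open>\<tau>\<close> (\<open>extension_over_D\<close>).
\<close>

section \<open>Arrows in preadditive categories\<close>

context category
begin

lemma Hom_objects:
  assumes "f \<in> Hom C X Y"
  shows "X \<in> Obj C" "Y \<in> Obj C"
  using assms Dom_in_Obj Cod_in_Obj by (auto simp: Hom_def)

lemma Hom_Dom_Cod:
  assumes "f \<in> Hom C X Y"
  shows "f \<in> Arr C" "Dom C f = X" "Cod C f = Y"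
  using assms by (auto simp: Hom_def)

end

context preadditive_category
begin

lemma Zero_in_Hom: "X \<in> Obj C \<Longrightarrow> Y \<in> Obj C \<Longrightarrow> Zero C X Y \<in> Hom C X Y"
  using monoid.one_closed[OF group.is_monoid[OF comm_group.axioms(2)[OF comm_group_Hom]], of X Y]
  by (simp add: Hom_group_def)

lemma Add_in_Hom:
  assumes "f \<in> Hom C X Y" "g \<in> Hom C X Y"
  shows "f \<boxplus> g \<in> Hom C X Y"
proof -
  interpret G: comm_group "Hom_group C X Y"
    by (rule comm_group_Hom[OF Hom_objects[OF assms(1)]])
  show ?thesis using G.m_closed assms by (simp add: Hom_group_def)
qed

lemma Add_Zero:
  assumes "f \<in> Hom C X Y"
  shows "f \<boxplus> Zero C X Y = f" "Zero C X Y \<boxplus> f = f"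
proof -
  interpret G: comm_group "Hom_group C X Y"
    by (rule comm_group_Hom[OF Hom_objects[OF assms(1)]])
  show "f \<boxplus> Zero C X Y = f" "Zero C X Y \<boxplus> f = f"
    using G.l_one G.r_one assms by (simp_all add: Hom_group_def)
qed

lemma Add_cancel:
  assumes "f \<in> Hom C X Y" "g \<in> Hom C X Y" "f \<boxplus> g = g"
  shows "f = Zero C X Y"
proof -
  interpret G: comm_group "Hom_group C X Y"
    by (rule comm_group_Hom[OF Hom_objects[OF assms(1)]])
  show ?thesis using G.r_cancel_one[of g f] assms by (simp add: Hom_group_def)
qed

text \<open>Subtraction enters only through the existence of differences, so no notation for inverses is
  introduced.\<close>

lemma difference_exists:
  assumes "f \<in> Hom C X Y" "g \<in> Hom C X Y"
  shows "\<exists>e \<in> Hom C X Y. e \<boxplus> g = f"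
proof -
  interpret G: comm_group "Hom_group C X Y"
    by (rule comm_group_Hom[OF Hom_objects[OF assms(1)]])
  have c: "f \<in> carrier (Hom_group C X Y)" "g \<in> carrier (Hom_group C X Y)"
    using assms by (simp_all add: Hom_group_def)
  then have "(f \<otimes>\<^bsub>Hom_group C X Y\<^esub> inv\<^bsub>Hom_group C X Y\<^esub> g) \<otimes>\<^bsub>Hom_group C X Y\<^esub> g = f"
    by (simp add: G.m_assoc)
  moreover have "f \<otimes>\<^bsub>Hom_group C X Y\<^esub> inv\<^bsub>Hom_group C X Y\<^esub> g \<in> carrier (Hom_group C X Y)"
    using c by simp
  ultimately show ?thesis by (auto simp: Hom_group_def)
qed

lemma Comp_Zero_right:
  assumes "g \<in> Hom C Y Z" "X \<in> Obj C"
  shows "g \<cdot> Zero C X Y = Zero C X Z"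
proof -
  have z: "Zero C X Y \<in> Hom C X Y" using Zero_in_Hom assms Hom_objects by blast
  have "g \<cdot> Zero C X Y \<boxplus> g \<cdot> Zero C X Y = g \<cdot> Zero C X Y"
    using Comp_Add_right[OF z z assms(1)] Add_Zero(1)[OF z] by simp
  then show ?thesis using Add_cancel Comp_in_Hom[OF z assms(1)] by blast
qed

lemma Comp_Zero_left:
  assumes "f \<in> Hom C X Y" "Z \<in> Obj C"
  shows "Zero C Y Z \<cdot> f = Zero C X Z"
proof -
  have z: "Zero C Y Z \<in> Hom C Y Z" using Zero_in_Hom assms Hom_objects by blast
  have "Zero C Y Z \<cdot> f \<boxplus> Zero C Y Z \<cdot> f = Zero C Y Z \<cdot> f"
    using Comp_Add_left[OF assms(1) z z] Add_Zero(1)[OF z] by simp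
  then show ?thesis using Add_cancel Comp_in_Hom[OF assms(1) z] by blast
qed

lemma is_monoI:
  assumes f: "f \<in> Hom C X Y"
    and cancel: "\<And>W x. x \<in> Hom C W X \<Longrightarrow> f \<cdot> x = Zero C W Y \<Longrightarrow> x = Zero C W X"
  shows "is_mono C f"
proof -
  have "g = h" if g: "g \<in> Hom C W X" and h: "h \<in> Hom C W X" and eq: "f \<cdot> g = f \<cdot> h" for W g h
  proof -
    obtain e where e: "e \<in> Hom C W X" "e \<boxplus> h = g" using difference_exists[OF g h] by blast
    have "f \<cdot> e \<boxplus> f \<cdot> h = f \<cdot> h" using Comp_Add_right[OF e(1) h f] e(2) eq by simp
    then have "f \<cdot> e = Zero C W Y"
      using Add_cancel[OF Comp_in_Hom[OF e(1) f] Comp_in_Hom[OF h f]] by simp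
    then have "e = Zero C W X" using cancel[OF e(1)] by simp
    then show ?thesis using e(2) Add_Zero(2)[OF h] by simp
  qed
  then show ?thesis using Hom_Dom_Cod[OF f] unfolding is_mono_def by blast
qed

lemma monoD:
  assumes "is_mono C f" "f \<in> Hom C X Y" "g \<in> Hom C W X" "h \<in> Hom C W X" "f \<cdot> g = f \<cdot> h"
  shows "g = h"
  using assms Hom_Dom_Cod[OF assms(2)] unfolding is_mono_def by blast

lemma epiD:
  assumes "is_epi C f" "f \<in> Hom C X Y" "g \<in> Hom C Y W" "h \<in> Hom C Y W" "g \<cdot> f = h \<cdot> f"
  shows "g = h"
  using assms Hom_Dom_Cod[OF assms(2)] unfolding is_epi_def by blast

lemma Comp_mono:
  assumes f: "f \<in> Hom C X Y" "is_mono C f" and g: "g \<in> Hom C Y Z" "is_mono C g"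
  shows "is_mono C (g \<cdot> f)"
proof (rule is_monoI[OF Comp_in_Hom[OF f(1) g(1)]])
  fix W x assume x: "x \<in> Hom C W X" and 0: "g \<cdot> f \<cdot> x = Zero C W Z"
  have W: "W \<in> Obj C" and XY: "X \<in> Obj C" "Y \<in> Obj C"
    using x f Hom_objects by blast+
  have "g \<cdot> (f \<cdot> x) = g \<cdot> Zero C W Y"
    using 0 Comp_assoc[OF x f(1) g(1)] Comp_Zero_right[OF g(1) W] by simp
  then have "f \<cdot> x = f \<cdot> Zero C W X"
    using monoD[OF g(2,1) Comp_in_Hom[OF x f(1)] Zero_in_Hom[OF W XY(2)]]
      Comp_Zero_right[OF f(1) W] by simp
  then show "x = Zero C W X"
    using monoD[OF f(2,1) x Zero_in_Hom[OF W XY(1)]] by blast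
qed

lemma kernelD:
  assumes "is_kernel C f K k" "f \<in> Hom C X Y"
  shows "k \<in> Hom C K X" "f \<cdot> k = Zero C K Y"
    "\<And>W g. g \<in> Hom C W X \<Longrightarrow> f \<cdot> g = Zero C W Y \<Longrightarrow> \<exists>u \<in> Hom C W K. k \<cdot> u = g"
  using assms Hom_Dom_Cod[OF assms(2)] unfolding is_kernel_def by blast+

lemma cokernelD:
  assumes "is_cokernel C f Q q" "f \<in> Hom C X Y"
  shows "q \<in> Hom C Y Q" "q \<cdot> f = Zero C X Q"
    "\<And>W g. g \<in> Hom C Y W \<Longrightarrow> g \<cdot> f = Zero C X W \<Longrightarrow> \<exists>u \<in> Hom C Q W. u \<cdot> q = g"
  using assms Hom_Dom_Cod[OF assms(2)] unfolding is_cokernel_def by blast+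

lemma kernel_is_mono:
  assumes "is_kernel C f K k"
  shows "is_mono C k"
proof -
  let ?X = "Dom C f" let ?Y = "Cod C f"
  have f: "f \<in> Hom C ?X ?Y" using assms by (simp add: is_kernel_def Hom_def)
  note k = kernelD[OF assms f]
  show ?thesis
  proof (rule is_monoI[OF k(1)])
    fix W x assume x: "x \<in> Hom C W K" and 0: "k \<cdot> x = Zero C W ?X"
    have W: "W \<in> Obj C" and ob: "K \<in> Obj C" "?X \<in> Obj C"
      using x k(1) Hom_objects by blast+
    have z: "Zero C W K \<in> Hom C W K" by (rule Zero_in_Hom[OF W ob(1)])
    have "Zero C W ?X \<in> Hom C W ?X" "f \<cdot> Zero C W ?X = Zero C W ?Y"
      using Zero_in_Hom W ob Comp_Zero_right[OF f W] by auto
    then have "\<exists>!u. u \<in> Hom C W K \<and> k \<cdot> u = Zero C W ?X"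
      using assms unfolding is_kernel_def by blast
    then show "x = Zero C W K" using x 0 z Comp_Zero_right[OF k(1) W] by blast
  qed
qed

lemma cokernel_is_epi:
  assumes "is_cokernel C f Q q"
  shows "is_epi C q"
proof -
  let ?X = "Dom C f" let ?Y = "Cod C f"
  have f: "f \<in> Hom C ?X ?Y" using assms by (simp add: is_cokernel_def Hom_def)
  note q = cokernelD[OF assms f]
  have "g = h" if g: "g \<in> Hom C Q W" and h: "h \<in> Hom C Q W" and eq: "g \<cdot> q = h \<cdot> q" for W g h
  proof -
    have W: "W \<in> Obj C" using g Hom_objects by blast
    have "h \<cdot> q \<cdot> f = Zero C ?X W"
      using Comp_assoc[OF f q(1) h] q(2) Comp_Zero_right[OF h] Hom_objects[OF f] by simp
    then have "\<exists>!u. u \<in> Hom C Q W \<and> u \<cdot> q = h \<cdot> q"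
      using assms Comp_in_Hom[OF q(1) h] unfolding is_cokernel_def by blast
    then show ?thesis using g h eq by blast
  qed
  then show ?thesis using Hom_Dom_Cod[OF q(1)] unfolding is_epi_def by blast
qed

section \<open>Direct sums\<close>

lemma finprod_empty_Hom:
  assumes "X \<in> Obj C" "Y \<in> Obj C"
  shows "finprod (Hom_group C X Y) F {} = Zero C X Y"
proof -
  interpret G: comm_group "Hom_group C X Y" by (rule comm_group_Hom[OF assms])
  show ?thesis using G.finprod_empty[of F] by (simp add: Hom_group_def)
qed

lemma Comp_finprod_right:
  assumes "finite J" "X \<in> Obj C" "g \<in> Hom C Y Z" "\<And>j. j \<in> J \<Longrightarrow> F j \<in> Hom C X Y"
  shows "finprod (Hom_group C X Y) F J \<in> Hom C X Y \<and>
    g \<cdot> finprod (Hom_group C X Y) F J = finprod (Hom_group C X Z) (\<lambda>j. g \<cdot> F j) J"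
  using assms(1,4)
proof (induction J)
  case empty
  show ?case
    using Comp_Zero_right[OF assms(3,2)] Zero_in_Hom[OF assms(2)] Hom_objects[OF assms(3)]
    by (simp add: finprod_empty_Hom assms(2))
next
  case (insert a J)
  interpret G: comm_group "Hom_group C X Y"
    by (rule comm_group_Hom[OF assms(2) Hom_objects(1)[OF assms(3)]])
  interpret H: comm_group "Hom_group C X Z"
    by (rule comm_group_Hom[OF assms(2) Hom_objects(2)[OF assms(3)]])
  have F: "F a \<in> Hom C X Y" "\<And>j. j \<in> J \<Longrightarrow> F j \<in> Hom C X Y" using insert.prems by auto
  have IH: "finprod (Hom_group C X Y) F J \<in> Hom C X Y"
    "g \<cdot> finprod (Hom_group C X Y) F J = finprod (Hom_group C X Z) (\<lambda>j. g \<cdot> F j) J"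
    using insert.IH F by blast+
  have "finprod (Hom_group C X Y) F (insert a J) = F a \<boxplus> finprod (Hom_group C X Y) F J"
    using insert.hyps F by (subst G.finprod_insert) (auto simp: Hom_group_def)
  moreover have "finprod (Hom_group C X Z) (\<lambda>j. g \<cdot> F j) (insert a J) =
      g \<cdot> F a \<boxplus> finprod (Hom_group C X Z) (\<lambda>j. g \<cdot> F j) J"
    using insert.hyps F Comp_in_Hom[OF _ assms(3)]
    by (subst H.finprod_insert) (auto simp: Hom_group_def)
  ultimately show ?case
    using IH F Comp_Add_right[OF F(1) IH(1) assms(3)] Add_in_Hom by simp
qed

lemma Comp_finprod_left:
  assumes "finite J" "Z \<in> Obj C" "f \<in> Hom C X Y" "\<And>j. j \<in> J \<Longrightarrow> F j \<in> Hom C Y Z"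
  shows "finprod (Hom_group C Y Z) F J \<in> Hom C Y Z \<and>
    finprod (Hom_group C Y Z) F J \<cdot> f = finprod (Hom_group C X Z) (\<lambda>j. F j \<cdot> f) J"
  using assms(1,4)
proof (induction J)
  case empty
  show ?case
    using Comp_Zero_left[OF assms(3,2)] Zero_in_Hom[OF _ assms(2)] Hom_objects[OF assms(3)]
    by (simp add: finprod_empty_Hom assms(2))
next
  case (insert a J)
  interpret G: comm_group "Hom_group C Y Z"
    by (rule comm_group_Hom[OF Hom_objects(2)[OF assms(3)] assms(2)])
  interpret H: comm_group "Hom_group C X Z"
    by (rule comm_group_Hom[OF Hom_objects(1)[OF assms(3)] assms(2)])
  have F: "F a \<in> Hom C Y Z" "\<And>j. j \<in> J \<Longrightarrow> F j \<in> Hom C Y Z" using insert.prems by auto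
  have IH: "finprod (Hom_group C Y Z) F J \<in> Hom C Y Z"
    "finprod (Hom_group C Y Z) F J \<cdot> f = finprod (Hom_group C X Z) (\<lambda>j. F j \<cdot> f) J"
    using insert.IH F by blast+
  have "finprod (Hom_group C Y Z) F (insert a J) = F a \<boxplus> finprod (Hom_group C Y Z) F J"
    using insert.hyps F by (subst G.finprod_insert) (auto simp: Hom_group_def)
  moreover have "finprod (Hom_group C X Z) (\<lambda>j. F j \<cdot> f) (insert a J) =
      F a \<cdot> f \<boxplus> finprod (Hom_group C X Z) (\<lambda>j. F j \<cdot> f) J"
    using insert.hyps F Comp_in_Hom[OF assms(3)]
    by (subst H.finprod_insert) (auto simp: Hom_group_def)
  ultimately show ?case
    using IH F Comp_Add_left[OF assms(3) F(1) IH(1)] Add_in_Hom by simp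
qed

lemma direct_sumD:
  assumes "is_direct_sum C J X S \<iota> \<pi>"
  shows "finite J" "S \<in> Obj C" "\<And>j. j \<in> J \<Longrightarrow> \<iota> j \<in> Hom C (X j) S"
    "\<And>j. j \<in> J \<Longrightarrow> \<pi> j \<in> Hom C S (X j)" "\<And>j. j \<in> J \<Longrightarrow> X j \<in> Obj C"
    "\<And>j. j \<in> J \<Longrightarrow> \<pi> j \<cdot> \<iota> j = Ide C (X j)"
    "\<And>i j. i \<in> J \<Longrightarrow> j \<in> J \<Longrightarrow> i \<noteq> j \<Longrightarrow> \<pi> j \<cdot> \<iota> i = Zero C (X i) (X j)"
    "finprod (Hom_group C S S) (\<lambda>j. \<iota> j \<cdot> \<pi> j) J = Ide C S"
  using assms Hom_objects unfolding is_direct_sum_def by (auto; blast)+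

lemma Comp_through_sum:
  assumes S: "is_direct_sum C J X S \<iota> \<pi>" and h: "h \<in> Hom C S Y" and x: "x \<in> Hom C W S"
  shows "h \<cdot> x = finprod (Hom_group C W Y) (\<lambda>j. (h \<cdot> \<iota> j) \<cdot> (\<pi> j \<cdot> x)) J"
proof -
  note D = direct_sumD[OF S]
  have hx: "Y \<in> Obj C" "W \<in> Obj C" using h x Hom_objects by auto
  interpret G: comm_group "Hom_group C W Y" by (rule comm_group_Hom[OF hx(2,1)])
  have t: "\<And>j. j \<in> J \<Longrightarrow> \<iota> j \<cdot> \<pi> j \<in> Hom C S S" using D Comp_in_Hom by blast
  have "h = finprod (Hom_group C S Y) (\<lambda>j. h \<cdot> (\<iota> j \<cdot> \<pi> j)) J"
    using Comp_finprod_right[OF D(1,2) h, of "\<lambda>j. \<iota> j \<cdot> \<pi> j"] t D(8) Comp_Ide_right[OF h] by simp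
  then have "h \<cdot> x = finprod (Hom_group C S Y) (\<lambda>j. h \<cdot> (\<iota> j \<cdot> \<pi> j)) J \<cdot> x" by simp
  also have "\<dots> = finprod (Hom_group C W Y) (\<lambda>j. h \<cdot> (\<iota> j \<cdot> \<pi> j) \<cdot> x) J"
    using Comp_finprod_left[OF D(1) hx(1) x, of "\<lambda>j. h \<cdot> (\<iota> j \<cdot> \<pi> j)"] t Comp_in_Hom[OF _ h]
    by blast
  also have "\<dots> = finprod (Hom_group C W Y) (\<lambda>j. (h \<cdot> \<iota> j) \<cdot> (\<pi> j \<cdot> x)) J"
  proof (rule G.finprod_cong')
    show "(\<lambda>j. (h \<cdot> \<iota> j) \<cdot> (\<pi> j \<cdot> x)) \<in> J \<rightarrow> carrier (Hom_group C W Y)"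
      using D h x by (auto simp: Hom_group_def intro!: Comp_in_Hom)
    fix j assume j: "j \<in> J"
    show "h \<cdot> (\<iota> j \<cdot> \<pi> j) \<cdot> x = (h \<cdot> \<iota> j) \<cdot> (\<pi> j \<cdot> x)"
      using Comp_assoc[OF D(4)[OF j] D(3)[OF j] h]
        Comp_assoc[OF x D(4)[OF j] Comp_in_Hom[OF D(3)[OF j] h]] by simp
  qed simp
  finally show ?thesis .
qed

text \<open>In each matrix product evaluated later, a filtration makes all terms but one vanish.\<close>

lemma Comp_single_summand:
  assumes S: "is_direct_sum C J X S \<iota> \<pi>" and h: "h \<in> Hom C S Y" and x: "x \<in> Hom C W S"
    and i: "i \<in> J"
    and 0: "\<And>j. j \<in> J \<Longrightarrow> j \<noteq> i \<Longrightarrow> h \<cdot> \<iota> j = Zero C (X j) Y \<or> \<pi> j \<cdot> x = Zero C W (X j)"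
  shows "h \<cdot> x = (h \<cdot> \<iota> i) \<cdot> (\<pi> i \<cdot> x)"
proof -
  note D = direct_sumD[OF S]
  have hx: "Y \<in> Obj C" "W \<in> Obj C" using h x Hom_objects by auto
  interpret G: comm_group "Hom_group C W Y" by (rule comm_group_Hom[OF hx(2,1)])
  have c: "(h \<cdot> \<iota> i) \<cdot> (\<pi> i \<cdot> x) \<in> Hom C W Y"
    using D i h x by (auto intro!: Comp_in_Hom)
  have "finprod (Hom_group C W Y) (\<lambda>j. (h \<cdot> \<iota> j) \<cdot> (\<pi> j \<cdot> x)) J =
    finprod (Hom_group C W Y)
      (\<lambda>j. if i = j then (h \<cdot> \<iota> i) \<cdot> (\<pi> i \<cdot> x) else \<one>\<^bsub>Hom_group C W Y\<^esub>) J"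
  proof (rule G.finprod_cong')
    fix j assume j: "j \<in> J"
    have "(h \<cdot> \<iota> j) \<cdot> (\<pi> j \<cdot> x) = Zero C W Y" if "j \<noteq> i"
      using 0[OF j that]
        Comp_Zero_left[OF Comp_in_Hom[OF x D(4)[OF j]] hx(1)]
        Comp_Zero_right[OF Comp_in_Hom[OF D(3)[OF j] h] hx(2)] by auto
    then show "(h \<cdot> \<iota> j) \<cdot> (\<pi> j \<cdot> x) =
        (if i = j then (h \<cdot> \<iota> i) \<cdot> (\<pi> i \<cdot> x) else \<one>\<^bsub>Hom_group C W Y\<^esub>)"
      by (auto simp: Hom_group_def)
  qed (use c Zero_in_Hom[OF hx(2,1)] in \<open>auto simp: Hom_group_def\<close>)
  also have "\<dots> = (h \<cdot> \<iota> i) \<cdot> (\<pi> i \<cdot> x)"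
    using i D(1) c by (intro G.finprod_singleton) (auto simp: Hom_group_def)
  finally show ?thesis using Comp_through_sum[OF S h x] by simp
qed

lemma eq_on_summands:
  assumes S: "is_direct_sum C J X S \<iota> \<pi>" and h: "h \<in> Hom C S Y" "h' \<in> Hom C S Y"
    and eq: "\<And>j. j \<in> J \<Longrightarrow> h \<cdot> \<iota> j = h' \<cdot> \<iota> j"
  shows "h = h'"
proof -
  note D = direct_sumD[OF S]
  have I: "Ide C S \<in> Hom C S S" using Ide_in_Hom D by blast
  have Y: "Y \<in> Obj C" using h Hom_objects by blast
  interpret G: comm_group "Hom_group C S Y" by (rule comm_group_Hom[OF D(2) Y])
  have "h \<cdot> Ide C S = h' \<cdot> Ide C S"
    unfolding Comp_through_sum[OF S h(1) I] Comp_through_sum[OF S h(2) I]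
    using eq D h I by (intro G.finprod_cong') (auto simp: Hom_group_def intro!: Comp_in_Hom)
  then show ?thesis using Comp_Ide_right h by simp
qed

lemma eq_on_projections:
  assumes S: "is_direct_sum C J X S \<iota> \<pi>" and x: "x \<in> Hom C W S" "x' \<in> Hom C W S"
    and eq: "\<And>j. j \<in> J \<Longrightarrow> \<pi> j \<cdot> x = \<pi> j \<cdot> x'"
  shows "x = x'"
proof -
  note D = direct_sumD[OF S]
  have I: "Ide C S \<in> Hom C S S" using Ide_in_Hom D by blast
  have W: "W \<in> Obj C" using x Hom_objects by blast
  interpret G: comm_group "Hom_group C W S" by (rule comm_group_Hom[OF W D(2)])
  have "Ide C S \<cdot> x = Ide C S \<cdot> x'"
    unfolding Comp_through_sum[OF S I x(1)] Comp_through_sum[OF S I x(2)]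
    using eq D x I by (intro G.finprod_cong') (auto simp: Hom_group_def intro!: Comp_in_Hom)
  then show ?thesis using Comp_Ide_left x by simp
qed

lemma arrow_from_sum:
  assumes S: "is_direct_sum C J X S \<iota> \<pi>" and Y: "Y \<in> Obj C"
    and f: "\<And>j. j \<in> J \<Longrightarrow> f j \<in> Hom C (X j) Y"
  shows "\<exists>h \<in> Hom C S Y. \<forall>j \<in> J. h \<cdot> \<iota> j = f j"
proof -
  note D = direct_sumD[OF S]
  let ?h = "finprod (Hom_group C S Y) (\<lambda>j. f j \<cdot> \<pi> j) J"
  have t: "f j \<cdot> \<pi> j \<in> Hom C S Y" if "j \<in> J" for j
    using that f D Comp_in_Hom by blast
  have "?h \<in> Hom C S Y"
    using Comp_finprod_left[OF D(1) Y Ide_in_Hom[OF D(2)], of "\<lambda>j. f j \<cdot> \<pi> j"] t by blast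
  moreover have "?h \<cdot> \<iota> i = f i" if i: "i \<in> J" for i
  proof -
    interpret G: comm_group "Hom_group C (X i) Y" by (rule comm_group_Hom[OF D(5)[OF i] Y])
    have "?h \<cdot> \<iota> i = finprod (Hom_group C (X i) Y) (\<lambda>j. f j \<cdot> \<pi> j \<cdot> \<iota> i) J"
      using Comp_finprod_left[OF D(1) Y D(3)[OF i], of "\<lambda>j. f j \<cdot> \<pi> j"] t by blast
    also have "\<dots> = finprod (Hom_group C (X i) Y)
        (\<lambda>j. if i = j then f i else \<one>\<^bsub>Hom_group C (X i) Y\<^esub>) J"
    proof (rule G.finprod_cong')
      fix j assume j: "j \<in> J"
      have "f j \<cdot> \<pi> j \<cdot> \<iota> i = f j \<cdot> (\<pi> j \<cdot> \<iota> i)"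
        by (rule Comp_assoc[OF D(3)[OF i] D(4)[OF j] f[OF j]])
      then show "f j \<cdot> \<pi> j \<cdot> \<iota> i = (if i = j then f i else \<one>\<^bsub>Hom_group C (X i) Y\<^esub>)"
        using D(6)[OF i] D(7)[OF i j] Comp_Ide_right[OF f[OF i]]
          Comp_Zero_right[OF f[OF j] D(5)[OF i]]
        by (auto simp: Hom_group_def)
    qed (use f[OF i] Zero_in_Hom[OF D(5)[OF i] Y] in \<open>auto simp: Hom_group_def\<close>)
    also have "\<dots> = f i"
      using i D(1) f[OF i] by (intro G.finprod_singleton) (auto simp: Hom_group_def)
    finally show ?thesis .
  qed
  ultimately show ?thesis by blast
qed

lemma arrow_into_sum:
  assumes S: "is_direct_sum C J X S \<iota> \<pi>" and W: "W \<in> Obj C"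
    and f: "\<And>j. j \<in> J \<Longrightarrow> f j \<in> Hom C W (X j)"
  shows "\<exists>x \<in> Hom C W S. \<forall>j \<in> J. \<pi> j \<cdot> x = f j"
proof -
  note D = direct_sumD[OF S]
  let ?x = "finprod (Hom_group C W S) (\<lambda>j. \<iota> j \<cdot> f j) J"
  have t: "\<iota> j \<cdot> f j \<in> Hom C W S" if "j \<in> J" for j
    using that f D Comp_in_Hom by blast
  have "?x \<in> Hom C W S"
    using Comp_finprod_right[OF D(1) W Ide_in_Hom[OF D(2)], of "\<lambda>j. \<iota> j \<cdot> f j"] t by blast
  moreover have "\<pi> i \<cdot> ?x = f i" if i: "i \<in> J" for i
  proof -
    interpret G: comm_group "Hom_group C W (X i)" by (rule comm_group_Hom[OF W D(5)[OF i]])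
    have "\<pi> i \<cdot> ?x = finprod (Hom_group C W (X i)) (\<lambda>j. \<pi> i \<cdot> (\<iota> j \<cdot> f j)) J"
      using Comp_finprod_right[OF D(1) W D(4)[OF i], of "\<lambda>j. \<iota> j \<cdot> f j"] t by blast
    also have "\<dots> = finprod (Hom_group C W (X i))
        (\<lambda>j. if i = j then f i else \<one>\<^bsub>Hom_group C W (X i)\<^esub>) J"
    proof (rule G.finprod_cong')
      fix j assume j: "j \<in> J"
      have "\<pi> i \<cdot> (\<iota> j \<cdot> f j) = \<pi> i \<cdot> \<iota> j \<cdot> f j"
        by (rule Comp_assoc[OF f[OF j] D(3)[OF j] D(4)[OF i], symmetric])
      then show "\<pi> i \<cdot> (\<iota> j \<cdot> f j) = (if i = j then f i else \<one>\<^bsub>Hom_group C W (X i)\<^esub>)"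
        using D(6)[OF i] D(7)[OF j i] Comp_Ide_left[OF f[OF i]]
          Comp_Zero_left[OF f[OF j] D(5)[OF i]]
        by (auto simp: Hom_group_def)
    qed (use f[OF i] Zero_in_Hom[OF W D(5)[OF i]] in \<open>auto simp: Hom_group_def\<close>)
    also have "\<dots> = f i"
      using i D(1) f[OF i] by (intro G.finprod_singleton) (auto simp: Hom_group_def)
    finally show ?thesis .
  qed
  ultimately show ?thesis by blast
qed

section \<open>Injective objects and exactness\<close>

lemma injective_extension:
  assumes "is_injective C Q" "is_mono C f" "f \<in> Hom C X Y" "g \<in> Hom C X Q"
  shows "\<exists>h \<in> Hom C Y Q. h \<cdot> f = g"
  using assms unfolding is_injective_def by blast

lemma direct_sum_injective:
  assumes S: "is_direct_sum C J X S \<iota> \<pi>" and inj: "\<And>j. j \<in> J \<Longrightarrow> is_injective C (X j)"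
  shows "is_injective C S"
  unfolding is_injective_def
proof (intro conjI allI ballI impI)
  note D = direct_sumD[OF S]
  show "S \<in> Obj C" by (rule D(2))
  fix U V f g assume f: "f \<in> Hom C U V" and g: "g \<in> Hom C U S" and m: "is_mono C f"
  have "\<exists>h \<in> Hom C V (X j). h \<cdot> f = \<pi> j \<cdot> g" if "j \<in> J" for j
    using injective_extension[OF inj[OF that] m f Comp_in_Hom[OF g D(4)[OF that]]] .
  then obtain h where h: "\<And>j. j \<in> J \<Longrightarrow> h j \<in> Hom C V (X j)"
      "\<And>j. j \<in> J \<Longrightarrow> h j \<cdot> f = \<pi> j \<cdot> g" by metis
  obtain x where x: "x \<in> Hom C V S" "\<forall>j \<in> J. \<pi> j \<cdot> x = h j"
    using arrow_into_sum[OF S Hom_objects(2)[OF f] h(1)] by blast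
  have "x \<cdot> f = g"
  proof (rule eq_on_projections[OF S Comp_in_Hom[OF f x(1)] g])
    fix j assume j: "j \<in> J"
    show "\<pi> j \<cdot> (x \<cdot> f) = \<pi> j \<cdot> g"
      using Comp_assoc[OF f x(1) D(4)[OF j]] x(2) h(2) j by simp
  qed
  then show "\<exists>h \<in> Hom C V S. h \<cdot> f = g" using x by blast
qed

end


text \<open>
  Exactness of \<open>X \<rightarrow> Y \<rightarrow> Z\<close> at \<open>Y\<close> after applying the contravariant functors \<open>Hom(-, Q)\<close> with \<open>Q\<close>
  injective; that \<open>g \<cdot> f\<close> vanishes is stated separately wherever it matters.
\<close>

definition hom_exact ::
    "('o, 'm, 'r) preadditive_category_scheme \<Rightarrow> 'o \<Rightarrow> 'o \<Rightarrow> 'o \<Rightarrow> 'm \<Rightarrow> 'm \<Rightarrow> bool" where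
  "hom_exact C X Y Z f g \<longleftrightarrow>
     (\<forall>Q. \<forall>h \<in> Hom C Y Q. is_injective C Q \<longrightarrow> h \<cdot>\<^bsub>C\<^esub> f = Zero C X Q \<longrightarrow>
        (\<exists>k \<in> Hom C Z Q. k \<cdot>\<^bsub>C\<^esub> g = h))"

context abelian_category
begin

text \<open>
  Let \<open>x\<close> be killed by \<open>m\<close> and \<open>q\<close> its cokernel.  Then \<open>g\<close> factors through the epimorphism
  \<open>q \<cdot> e\<close>, which is the cokernel of some \<open>y\<close>.  As \<open>g\<close> kills \<open>y\<close>, this \<open>y\<close> comes from the
  kernel of \<open>g\<close>, and so \<open>e\<close> kills it as well; hence \<open>e\<close> factors back through \<open>q \<cdot> e\<close>.  So \<open>q\<close> is
  a split monomorphism, which forces \<open>x\<close> to vanish.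
\<close>

lemma image_factorization:
  assumes g: "g \<in> Hom C Y Z" and K: "is_kernel C g K k" and R: "is_cokernel C k R e"
  shows "\<exists>m \<in> Hom C R Z. m \<cdot> e = g \<and> is_mono C m"
proof -
  note k = kernelD[OF K g]
  note e = cokernelD[OF R k(1)]
  obtain m where m: "m \<in> Hom C R Z" "m \<cdot> e = g" using e(3)[OF g k(2)] by blast
  have "is_mono C m"
  proof (rule is_monoI[OF m(1)])
    fix W x assume x: "x \<in> Hom C W R" and 0: "m \<cdot> x = Zero C W Z"
    have W: "W \<in> Obj C" and obR: "R \<in> Obj C" using Hom_objects[OF x] by auto
    obtain P q where P: "is_cokernel C x P q" using has_cokernels Hom_Dom_Cod(1)[OF x] by blast
    note q = cokernelD[OF P x]
    have obP: "P \<in> Obj C" using Hom_objects[OF q(1)] by auto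
    obtain m' where m': "m' \<in> Hom C P Z" "m' \<cdot> q = m" using q(3)[OF m(1) 0] by blast
    have qe: "q \<cdot> e \<in> Hom C Y P" by (rule Comp_in_Hom[OF e(1) q(1)])
    have "is_epi C (q \<cdot> e)"
    proof -
      have "a = b" if a: "a \<in> Hom C P V" and b: "b \<in> Hom C P V" and ab: "a \<cdot> (q \<cdot> e) = b \<cdot> (q \<cdot> e)"
        for V a b
      proof -
        have "a \<cdot> q \<cdot> e = b \<cdot> q \<cdot> e"
          using ab Comp_assoc[OF e(1) q(1) a] Comp_assoc[OF e(1) q(1) b] by simp
        then have "a \<cdot> q = b \<cdot> q"
          using epiD[OF cokernel_is_epi[OF R] e(1)] Comp_in_Hom[OF q(1)] a b by blast
        then show ?thesis using epiD[OF cokernel_is_epi[OF P] q(1)] a b by blast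
      qed
      then show ?thesis unfolding is_epi_def using Hom_Dom_Cod[OF qe] by blast
    qed
    then obtain y where y: "is_cokernel C y P (q \<cdot> e)"
      using epi_is_cokernel Hom_Dom_Cod(3)[OF qe] by metis
    have y1: "y \<in> Hom C (Dom C y) Y"
      using y Hom_Dom_Cod(2)[OF qe] unfolding is_cokernel_def Hom_def by auto
    let ?V = "Dom C y"
    note qy = cokernelD[OF y y1]
    have V: "?V \<in> Obj C" using Hom_objects[OF y1] by auto
    have "g \<cdot> y = Zero C ?V Z"
    proof -
      have "g = m' \<cdot> (q \<cdot> e)" using m(2) m'(2) Comp_assoc[OF e(1) q(1) m'(1)] by simp
      then have "g \<cdot> y = m' \<cdot> (q \<cdot> e \<cdot> y)" using Comp_assoc[OF y1 qe m'(1)] by simp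
      then show ?thesis using qy(2) Comp_Zero_right[OF m'(1) V] by simp
    qed
    then obtain y' where y': "y' \<in> Hom C ?V K" "k \<cdot> y' = y" using k(3)[OF y1] by blast
    have "e \<cdot> y = Zero C ?V R"
      using Comp_assoc[OF y'(1) k(1) e(1)] y'(2) e(2) Comp_Zero_left[OF y'(1) obR] by simp
    then obtain t where t: "t \<in> Hom C P R" "t \<cdot> (q \<cdot> e) = e" using qy(3)[OF e(1)] by blast
    have I: "Ide C R \<in> Hom C R R" by (rule Ide_in_Hom[OF obR])
    have "t \<cdot> q \<cdot> e = Ide C R \<cdot> e"
      using t(2) Comp_assoc[OF e(1) q(1) t(1)] Comp_Ide_left[OF e(1)] by simp
    then have tq: "t \<cdot> q = Ide C R"
      using epiD[OF cokernel_is_epi[OF R] e(1) Comp_in_Hom[OF q(1) t(1)] I] by simp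
    have "x = t \<cdot> q \<cdot> x" using tq Comp_Ide_left[OF x] by simp
    also have "\<dots> = t \<cdot> Zero C W P" using Comp_assoc[OF x q(1) t(1)] q(2) by simp
    also have "\<dots> = Zero C W R" by (rule Comp_Zero_right[OF t(1) W])
    finally show "x = Zero C W R" .
  qed
  then show ?thesis using m by blast
qed

text \<open>An arrow that kills the kernel of \<open>g\<close> factors through the image of \<open>g\<close>, a subobject of \<open>Z\<close>,
  and extends from there by injectivity.\<close>

lemma kernel_imp_hom_exact:
  assumes g: "g \<in> Hom C Y Z" and K: "is_kernel C g K k"
  shows "hom_exact C K Y Z k g"
  unfolding hom_exact_def
proof (intro allI ballI impI)
  fix Q h assume h: "h \<in> Hom C Y Q" and Q: "is_injective C Q" and 0: "h \<cdot> k = Zero C K Q"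
  note k = kernelD[OF K g]
  obtain R e where R: "is_cokernel C k R e" using has_cokernels Hom_Dom_Cod(1)[OF k(1)] by blast
  note e = cokernelD[OF R k(1)]
  obtain m where m: "m \<in> Hom C R Z" "m \<cdot> e = g" "is_mono C m"
    using image_factorization[OF g K R] by blast
  obtain h' where h': "h' \<in> Hom C R Q" "h' \<cdot> e = h" using e(3)[OF h 0] by blast
  obtain x where x: "x \<in> Hom C Z Q" "x \<cdot> m = h'"
    using injective_extension[OF Q m(3,1) h'(1)] by blast
  have "x \<cdot> g = h" using Comp_assoc[OF e(1) m(1) x(1)] m(2) x(2) h'(2) by simp
  then show "\<exists>x \<in> Hom C Z Q. x \<cdot> g = h" using x by blast
qed

lemma zero_objectD:
  assumes "is_zero_object C Z" "f \<in> Hom C X Z"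
  shows "f = Zero C X Z"
  using assms Zero_in_Hom Hom_objects[OF assms(2)] unfolding is_zero_object_def by blast

lemma zero_objectI:
  assumes Z: "Z \<in> Obj C" and I: "Ide C Z = Zero C Z Z"
  shows "is_zero_object C Z"
proof -
  have "f = Zero C X Z" if "f \<in> Hom C X Z" for X f
    using Comp_Ide_left[OF that] Comp_Zero_left[OF that Z] I by simp
  moreover have "f = Zero C Z X" if "f \<in> Hom C Z X" for X f
    using Comp_Ide_right[OF that] Comp_Zero_right[OF that Z] I by simp
  ultimately show ?thesis
    unfolding is_zero_object_def using Z Zero_in_Hom by blast
qed

lemma vanishing_imp_hom_exact:
  assumes X: "cochain_complex C X d" and v: "cohomology_vanishes C X d (Suc k)"
  shows "hom_exact C (X k) (X (Suc k)) (X (Suc (Suc k))) (d k) (d (Suc k))"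
  unfolding hom_exact_def
proof (intro allI ballI impI)
  fix Q h assume h: "h \<in> Hom C (X (Suc k)) Q" and Q: "is_injective C Q"
    and 0: "h \<cdot> d k = Zero C (X k) Q"
  have d: "\<And>k. d k \<in> Hom C (X k) (X (Suc k))" using X by (simp add: cochain_complex_def)
  obtain Z K \<kappa> u q where Z: "is_zero_object C Z" and K: "is_kernel C (d (Suc k)) K \<kappa>"
    and u: "u \<in> Hom C (X k) K" "\<kappa> \<cdot> u = d k" and c: "is_cokernel C u Z q"
    using v unfolding cohomology_vanishes_def by auto
  note kap = kernelD[OF K d]
  note q = cokernelD[OF c u(1)]
  have hk: "h \<cdot> \<kappa> \<in> Hom C K Q" by (rule Comp_in_Hom[OF kap(1) h])
  have "h \<cdot> \<kappa> \<cdot> u = Zero C (X k) Q" using Comp_assoc[OF u(1) kap(1) h] u(2) 0 by simp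
  then obtain v where v: "v \<in> Hom C Z Q" "v \<cdot> q = h \<cdot> \<kappa>" using q(3)[OF hk] by blast
  have "q = Zero C K Z" by (rule zero_objectD[OF Z q(1)])
  then have "h \<cdot> \<kappa> = Zero C K Q" using v Comp_Zero_right[OF v(1)] Hom_objects[OF q(1)] by simp
  then show "\<exists>x \<in> Hom C (X (Suc (Suc k))) Q. x \<cdot> d (Suc k) = h"
    using kernel_imp_hom_exact[OF d K] h Q unfolding hom_exact_def by blast
qed

text \<open>
  Embed the cohomology object \<open>H\<close> in an injective \<open>Q\<close>.  The arrow from the cocycles onto \<open>H\<close> and
  into \<open>Q\<close> extends to all cochains, and the extension kills the coboundaries; by
  exactness it factors through the differential, so that it vanishes on cocycles.
\<close>

lemma hom_exact_imp_vanishing: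
  assumes en: "enough_injectives C" and X: "cochain_complex C X d"
    and ex: "hom_exact C (X k) (X (Suc k)) (X (Suc (Suc k))) (d k) (d (Suc k))"
  shows "cohomology_vanishes C X d (Suc k)"
proof -
  have d: "\<And>k. d k \<in> Hom C (X k) (X (Suc k))"
    and dd: "d (Suc k) \<cdot> d k = Zero C (X k) (X (Suc (Suc k)))"
    using X by (simp_all add: cochain_complex_def)
  obtain K \<kappa> where K: "is_kernel C (d (Suc k)) K \<kappa>" using has_kernels Hom_Dom_Cod(1)[OF d] by blast
  note kap = kernelD[OF K d]
  obtain u where u: "u \<in> Hom C (X k) K" "\<kappa> \<cdot> u = d k" using kap(3)[OF d dd] by blast
  obtain H q where c: "is_cokernel C u H q" using has_cokernels Hom_Dom_Cod(1)[OF u(1)] by blast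
  note q = cokernelD[OF c u(1)]
  have H: "H \<in> Obj C" and obK: "K \<in> Obj C" and obX: "X k \<in> Obj C"
    using Hom_objects[OF q(1)] Hom_objects[OF u(1)] by auto
  obtain Q j where Q: "is_injective C Q" and j: "j \<in> Hom C H Q" "is_mono C j"
    using en H unfolding enough_injectives_def by blast
  have obQ: "Q \<in> Obj C" using Hom_objects[OF j(1)] by auto
  have jq: "j \<cdot> q \<in> Hom C K Q" by (rule Comp_in_Hom[OF q(1) j(1)])
  obtain h where h: "h \<in> Hom C (X (Suc k)) Q" "h \<cdot> \<kappa> = j \<cdot> q"
    using injective_extension[OF Q kernel_is_mono[OF K] kap(1) jq] by blast
  have "h \<cdot> d k = j \<cdot> (q \<cdot> u)"
    using Comp_assoc[OF u(1) kap(1) h(1)] Comp_assoc[OF u(1) q(1) j(1)] u(2) h(2) by simp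
  also have "\<dots> = Zero C (X k) Q" using q(2) Comp_Zero_right[OF j(1) obX] by simp
  finally obtain x where x: "x \<in> Hom C (X (Suc (Suc k))) Q" "x \<cdot> d (Suc k) = h"
    using ex h Q unfolding hom_exact_def by blast
  have "j \<cdot> q = x \<cdot> (d (Suc k) \<cdot> \<kappa>)" using h(2) x(2) Comp_assoc[OF kap(1) d x(1)] by simp
  also have "\<dots> = Zero C H Q \<cdot> q"
    using kap(2) Comp_Zero_right[OF x(1) obK] Comp_Zero_left[OF q(1) obQ] by simp
  finally have j0: "j = Zero C H Q"
    using epiD[OF cokernel_is_epi[OF c] q(1) j(1) Zero_in_Hom[OF H obQ]] by simp
  have "j \<cdot> Ide C H = j \<cdot> Zero C H H"
    using Comp_Ide_right[OF j(1)] Comp_Zero_right[OF j(1) H] j0 by simp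
  then have "Ide C H = Zero C H H"
    using monoD[OF j(2,1) Ide_in_Hom[OF H] Zero_in_Hom[OF H H]] by simp
  then show ?thesis
    using zero_objectI[OF H] K u c unfolding cohomology_vanishes_def is_cohomology.simps by blast
qed

text \<open>
  The monomorphism \<open>k\<close> is the kernel of some \<open>c\<close>.  Composed with an embedding into an injective
  object, \<open>c\<close> factors through \<open>g\<close>; so whatever \<open>g\<close> kills is killed by \<open>c\<close> and lifts to \<open>A\<close>.
\<close>

lemma hom_exact_imp_kernel:
  assumes en: "enough_injectives C" and k: "k \<in> Hom C A Y" "is_mono C k"
    and g: "g \<in> Hom C Y Z" and 0: "g \<cdot> k = Zero C A Z" and ex: "hom_exact C A Y Z k g"
  shows "is_kernel C g A k"
proof -
  have "\<exists>!u. u \<in> Hom C W A \<and> k \<cdot> u = w" if w: "w \<in> Hom C W Y" and gw: "g \<cdot> w = Zero C W Z" for W w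
  proof -
    have W: "W \<in> Obj C" using Hom_objects[OF w] by auto
    obtain c where c: "is_kernel C c A k" using mono_is_kernel[OF k(2)] Hom_Dom_Cod[OF k(1)] by auto
    have c1: "c \<in> Hom C Y (Cod C c)"
      using c Hom_Dom_Cod(3)[OF k(1)] unfolding is_kernel_def Hom_def by auto
    let ?P = "Cod C c"
    note ck = kernelD[OF c c1]
    have P: "?P \<in> Obj C" and A: "A \<in> Obj C" using Hom_objects c1 k by auto
    obtain Q j where Q: "is_injective C Q" and j: "j \<in> Hom C ?P Q" "is_mono C j"
      using en P unfolding enough_injectives_def by blast
    have jc: "j \<cdot> c \<in> Hom C Y Q" by (rule Comp_in_Hom[OF c1 j(1)])
    have "j \<cdot> c \<cdot> k = Zero C A Q"
      using Comp_assoc[OF k(1) c1 j(1)] ck(2) Comp_Zero_right[OF j(1) A] by simp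
    then obtain x where x: "x \<in> Hom C Z Q" "x \<cdot> g = j \<cdot> c"
      using ex jc Q unfolding hom_exact_def by blast
    have "j \<cdot> (c \<cdot> w) = x \<cdot> (g \<cdot> w)"
      using Comp_assoc[OF w c1 j(1)] Comp_assoc[OF w g x(1)] x(2) by simp
    also have "\<dots> = j \<cdot> Zero C W ?P"
      using gw Comp_Zero_right[OF x(1) W] Comp_Zero_right[OF j(1) W] by simp
    finally have "c \<cdot> w = Zero C W ?P"
      using monoD[OF j(2,1) Comp_in_Hom[OF w c1] Zero_in_Hom[OF W P]] by simp
    then obtain u where "u \<in> Hom C W A" "k \<cdot> u = w" using ck(3)[OF w] by blast
    then show ?thesis using monoD[OF k(2,1)] by blast
  qed
  then show ?thesis
    unfolding is_kernel_def using Hom_Dom_Cod[OF g] k 0 by auto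
qed

end


section \<open>The augmented total complex\<close>

text \<open>
  The shift by 2 makes the diagonals 0 and 1 empty and the corresponding direct sums zero objects,
  so that the recursive construction of the differential can start from two zero arrows.
\<close>

definition diagonal :: "nat \<Rightarrow> (nat \<times> nat) set" where
  "diagonal l = {(m, p). m + p + 2 = l}"

lemma diagonal_iff [simp]: "(m, p) \<in> diagonal l \<longleftrightarrow> m + p + 2 = l"
  by (simp add: diagonal_def)

text \<open>
  \<open>J (m, 0)\<close> is the object \<open>M\<^sup>m\<close> of the complex to be resolved and \<open>J (m, n + 1)\<close> the
  object \<open>I\<^sup>m\<^sup>,\<^sup>n\<close> of its resolution; \<open>\<epsilon> m 0\<close> is the augmentation \<open>M\<^sup>m \<rightarrow> I\<^sup>m\<^sup>,\<^sup>0\<close>.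
  The complex \<open>M\<close> is the bottom row of this array.
\<close>

locale resolved_complex = abelian_category C
  for C :: "('o, 'm, 'r) preadditive_category_scheme" (structure) +
  fixes J :: "nat \<times> nat \<Rightarrow> 'o" and \<epsilon> :: "nat \<Rightarrow> nat \<Rightarrow> 'm" and \<tau> :: "nat \<Rightarrow> 'm"
    and X :: "nat \<Rightarrow> 'o" and \<iota> :: "nat \<Rightarrow> nat \<times> nat \<Rightarrow> 'm" and \<pi> :: "nat \<Rightarrow> nat \<times> nat \<Rightarrow> 'm"
  assumes row: "\<tau> m \<in> Hom C (J (m, 0)) (J (Suc m, 0))"
    and row_square: "\<tau> (Suc m) \<cdot> \<tau> m = Zero C (J (m, 0)) (J (Suc (Suc m), 0))"
    and column: "\<epsilon> m p \<in> Hom C (J (m, p)) (J (m, Suc p))"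
    and column_square: "\<epsilon> m (Suc p) \<cdot> \<epsilon> m p = Zero C (J (m, p)) (J (m, Suc (Suc p)))"
    and column_start: "is_injective C Q \<Longrightarrow> h \<in> Hom C (J (m, 0)) Q \<Longrightarrow>
          \<exists>k \<in> Hom C (J (m, Suc 0)) Q. k \<cdot> \<epsilon> m 0 = h"
    and column_exact: "hom_exact C (J (m, p)) (J (m, Suc p)) (J (m, Suc (Suc p)))
          (\<epsilon> m p) (\<epsilon> m (Suc p))"
    and injective_above: "is_injective C (J (m, Suc p))"
    and sum: "is_direct_sum C (diagonal l) J (X l) (\<iota> l) (\<pi> l)"
begin

lemmas X_Obj = direct_sumD(2)[OF sum]

lemma J_Obj: "J j \<in> Obj C"
  using Hom_objects(1)[OF column] by (cases j) blast

lemma inj_Hom: "m + p + 2 = l \<Longrightarrow> \<iota> l (m, p) \<in> Hom C (J (m, p)) (X l)"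
  and proj_Hom: "m + p + 2 = l \<Longrightarrow> \<pi> l (m, p) \<in> Hom C (X l) (J (m, p))"
  using direct_sumD(3,4)[OF sum] by auto

lemma column_extension:
  assumes Q: "is_injective C Q" and h: "h \<in> Hom C (J (m, p)) Q"
    and 0: "\<And>p'. p = Suc p' \<Longrightarrow> h \<cdot> \<epsilon> m p' = Zero C (J (m, p')) Q"
  shows "\<exists>k \<in> Hom C (J (m, Suc p)) Q. k \<cdot> \<epsilon> m p = h"
proof (cases p)
  case 0
  then show ?thesis using column_start[OF Q] h by simp
next
  case (Suc p')
  then show ?thesis using column_exact[of m p'] h Q assms(3)[OF Suc] unfolding hom_exact_def by blast
qed

definition component :: "nat \<Rightarrow> 'm \<Rightarrow> nat \<times> nat \<Rightarrow> nat \<times> nat \<Rightarrow> 'm" where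
  "component l d i j = \<pi> (Suc l) j \<cdot> (d \<cdot> \<iota> l i)"

text \<open>
  The shape required of the total differential: it respects the filtration by columns, has the
  column differentials on the diagonal, and in the bottom row has the component \<open>\<tau>\<close> from the
  bottom row and no other.  The last clause makes the part above the bottom row a subcomplex.
\<close>

definition triangular :: "nat \<Rightarrow> 'm \<Rightarrow> bool" where
  "triangular l d \<longleftrightarrow> d \<in> Hom C (X l) (X (Suc l)) \<and>
     (\<forall>m p m' p'. m + p + 2 = l \<longrightarrow> m' + p' + 2 = Suc l \<longrightarrow>
        (m' < m \<longrightarrow> component l d (m, p) (m', p') = Zero C (J (m, p)) (J (m', p'))) \<and>
        (m' = m \<longrightarrow> component l d (m, p) (m', p') = \<epsilon> m p) \<and>
        (p' = 0 \<longrightarrow> component l d (m, p) (m', p') =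
           (if p = 0 then \<tau> m else Zero C (J (m, p)) (J (m', p')))))"

lemma triangularD:
  assumes "triangular l d"
  shows "d \<in> Hom C (X l) (X (Suc l))"
    and "m + p + 2 = l \<Longrightarrow> m' + p' + 2 = Suc l \<Longrightarrow> m' < m \<Longrightarrow>
      \<pi> (Suc l) (m', p') \<cdot> (d \<cdot> \<iota> l (m, p)) = Zero C (J (m, p)) (J (m', p'))"
    and "m + p + 2 = l \<Longrightarrow> \<pi> (Suc l) (m, Suc p) \<cdot> (d \<cdot> \<iota> l (m, p)) = \<epsilon> m p"
    and "m + 0 + 2 = l \<Longrightarrow> \<pi> (Suc l) (Suc m, 0) \<cdot> (d \<cdot> \<iota> l (m, 0)) = \<tau> m"
    and "m + Suc p + 2 = l \<Longrightarrow> m' + 0 + 2 = Suc l \<Longrightarrow>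
      \<pi> (Suc l) (m', 0) \<cdot> (d \<cdot> \<iota> l (m, Suc p)) = Zero C (J (m, Suc p)) (J (m', 0))"
proof -
  show "d \<in> Hom C (X l) (X (Suc l))" using assms by (simp add: triangular_def)
  have *: "(m' < m \<longrightarrow> \<pi> (Suc l) (m', p') \<cdot> (d \<cdot> \<iota> l (m, p)) = Zero C (J (m, p)) (J (m', p'))) \<and>
      (m' = m \<longrightarrow> \<pi> (Suc l) (m', p') \<cdot> (d \<cdot> \<iota> l (m, p)) = \<epsilon> m p) \<and>
      (p' = 0 \<longrightarrow> \<pi> (Suc l) (m', p') \<cdot> (d \<cdot> \<iota> l (m, p)) =
         (if p = 0 then \<tau> m else Zero C (J (m, p)) (J (m', p'))))"
    if "m + p + 2 = l" "m' + p' + 2 = Suc l" for m p m' p'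
    using assms that unfolding triangular_def component_def by blast
  show "m + p + 2 = l \<Longrightarrow> m' + p' + 2 = Suc l \<Longrightarrow> m' < m \<Longrightarrow>
      \<pi> (Suc l) (m', p') \<cdot> (d \<cdot> \<iota> l (m, p)) = Zero C (J (m, p)) (J (m', p'))"
    using *[of m p m' p'] by blast
  show "m + p + 2 = l \<Longrightarrow> \<pi> (Suc l) (m, Suc p) \<cdot> (d \<cdot> \<iota> l (m, p)) = \<epsilon> m p"
    using *[of m p m "Suc p"] by simp
  show "m + 0 + 2 = l \<Longrightarrow> \<pi> (Suc l) (Suc m, 0) \<cdot> (d \<cdot> \<iota> l (m, 0)) = \<tau> m"
    using *[of m 0 "Suc m" 0] by simp
  show "m + Suc p + 2 = l \<Longrightarrow> m' + 0 + 2 = Suc l \<Longrightarrow>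
      \<pi> (Suc l) (m', 0) \<cdot> (d \<cdot> \<iota> l (m, Suc p)) = Zero C (J (m, Suc p)) (J (m', 0))"
    using *[of m "Suc p" m' 0] by simp
qed

text \<open>
  Induction on \<open>K\<close>.  Let \<open>f\<close> vanish on the columns beyond \<open>K\<close>.  On column \<open>K\<close> of the preceding
  degree, \<open>f \<cdot> d\<close> reduces to the restriction of \<open>f\<close> composed with the column
  differential, because the earlier columns are not reached by \<open>d\<close> and on the later ones \<open>f\<close>
  vanishes.  Exactness of that column extends the restriction to \<open>k\<close>, and subtracting \<open>k \<cdot> \<pi> \<cdot> d'\<close>
  from \<open>f\<close> clears one more column without disturbing the later ones.
\<close>

lemma filtered_exact:
  assumes d: "triangular l d" and d': "triangular (Suc l) d'"
    and dd: "d' \<cdot> d = Zero C (X l) (X (Suc (Suc l)))"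
    and Q: "is_injective C Q"
    and f: "f \<in> Hom C (X (Suc l)) Q" "f \<cdot> d = Zero C (X l) Q"
    and vanish: "\<And>m p. m + p + 2 = Suc l \<Longrightarrow> K \<le> m \<Longrightarrow> f \<cdot> \<iota> (Suc l) (m, p) = Zero C (J (m, p)) Q"
  shows "\<exists>x \<in> Hom C (X (Suc (Suc l))) Q. x \<cdot> d' = f \<and>
    (\<forall>m p. m + p + 2 = Suc (Suc l) \<longrightarrow> K \<le> m \<longrightarrow>
       x \<cdot> \<iota> (Suc (Suc l)) (m, p) = Zero C (J (m, p)) Q)"
  using f vanish
proof (induction K arbitrary: f)
  case 0
  have Qo: "Q \<in> Obj C" using Q by (simp add: is_injective_def)
  have z: "Zero C (X n) Q \<in> Hom C (X n) Q" for n by (rule Zero_in_Hom[OF X_Obj Qo])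
  have "f = Zero C (X (Suc l)) Q"
  proof (rule eq_on_summands[OF sum 0(1) z])
    fix i assume "i \<in> diagonal (Suc l)"
    then obtain m p where i: "i = (m, p)" and mp: "m + p + 2 = Suc l" by (cases i) auto
    show "f \<cdot> \<iota> (Suc l) i = Zero C (X (Suc l)) Q \<cdot> \<iota> (Suc l) i"
      using 0(3)[OF mp] Comp_Zero_left[OF inj_Hom[OF mp] Qo] i by simp
  qed
  then have "Zero C (X (Suc (Suc l))) Q \<cdot> d' = f"
    using Comp_Zero_left[OF triangularD(1)[OF d'] Qo] by simp
  then show ?case using z Comp_Zero_left[OF inj_Hom Qo] by blast
next
  case (Suc K)
  have Qo: "Q \<in> Obj C" using Q by (simp add: is_injective_def)
  note dH = triangularD(1)[OF d] and d'H = triangularD(1)[OF d']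
  show ?case
  proof (cases "K + 2 \<le> Suc l")
    case False
    then have "f \<cdot> \<iota> (Suc l) (m, p) = Zero C (J (m, p)) Q" if "m + p + 2 = Suc l" "K \<le> m" for m p
      using that by simp
    then show ?thesis using Suc.IH[OF Suc.prems(1,2)] by (meson Suc_leD)
  next
    case True
    then obtain p where p: "K + p + 2 = Suc l" by (metis add.assoc add.commute le_Suc_ex)
    define h where "h = f \<cdot> \<iota> (Suc l) (K, p)"
    have h: "h \<in> Hom C (J (K, p)) Q"
      unfolding h_def by (rule Comp_in_Hom[OF inj_Hom[OF p] Suc.prems(1)])
    have "h \<cdot> \<epsilon> K p' = Zero C (J (K, p')) Q" if p': "p = Suc p'" for p'
    proof -
      have i: "K + p' + 2 = l" using p p' by simp
      have di: "d \<cdot> \<iota> l (K, p') \<in> Hom C (J (K, p')) (X (Suc l))"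
        by (rule Comp_in_Hom[OF inj_Hom[OF i] dH])
      have "f \<cdot> (d \<cdot> \<iota> l (K, p')) = (f \<cdot> \<iota> (Suc l) (K, p)) \<cdot> (\<pi> (Suc l) (K, p) \<cdot> (d \<cdot> \<iota> l (K, p')))"
      proof (rule Comp_single_summand[OF sum Suc.prems(1) di])
        fix j assume j: "j \<in> diagonal (Suc l)" "j \<noteq> (K, p)"
        then obtain m q where mq: "j = (m, q)" "m + q + 2 = Suc l" by (cases j) auto
        with j(2) p have "m \<noteq> K" by auto
        then show "f \<cdot> \<iota> (Suc l) j = Zero C (J j) Q \<or>
            \<pi> (Suc l) j \<cdot> (d \<cdot> \<iota> l (K, p')) = Zero C (J (K, p')) (J j)"
          using triangularD(2)[OF d i mq(2)] Suc.prems(3)[OF mq(2)] mq(1)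
          by (cases "m < K") auto
      qed (use p in simp)
      also have "\<dots> = h \<cdot> \<epsilon> K p'" using triangularD(3)[OF d i] p' by (simp add: h_def)
      finally show ?thesis
        using Comp_assoc[OF inj_Hom[OF i] dH Suc.prems(1)] Suc.prems(2)
          Comp_Zero_left[OF inj_Hom[OF i] Qo] by simp
    qed
    then obtain k where k: "k \<in> Hom C (J (K, Suc p)) Q" "k \<cdot> \<epsilon> K p = h"
      using column_extension[OF Q h] by blast
    have Kp: "K + Suc p + 2 = Suc (Suc l)" using p by simp
    define g where "g = k \<cdot> \<pi> (Suc (Suc l)) (K, Suc p)"
    have g: "g \<in> Hom C (X (Suc (Suc l))) Q"
      unfolding g_def by (rule Comp_in_Hom[OF proj_Hom[OF Kp] k(1)])
    have gd: "g \<cdot> d' \<in> Hom C (X (Suc l)) Q" by (rule Comp_in_Hom[OF d'H g])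
    \<comment> \<open>the remainder of \<open>f\<close> after the correction on column \<open>K\<close>\<close>
    obtain f' where f': "f' \<in> Hom C (X (Suc l)) Q" "f' \<boxplus> g \<cdot> d' = f"
      using difference_exists[OF Suc.prems(1) gd] by blast
    have f'd: "f' \<cdot> d = Zero C (X l) Q"
    proof -
      have "g \<cdot> d' \<cdot> d = Zero C (X l) Q"
        using Comp_assoc[OF dH d'H g] dd Comp_Zero_right[OF g X_Obj] by simp
      then show ?thesis
        using Comp_Add_left[OF dH f'(1) gd] f'(2) Suc.prems(2) Add_Zero(1)[OF Comp_in_Hom[OF dH f'(1)]]
        by simp
    qed
    have f'v: "f' \<cdot> \<iota> (Suc l) (m, q) = Zero C (J (m, q)) Q"
      if mq: "m + q + 2 = Suc l" and m: "K \<le> m" for m q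
    proof -
      let ?i = "\<iota> (Suc l) (m, q)"
      note i = inj_Hom[OF mq]
      have di: "d' \<cdot> ?i \<in> Hom C (J (m, q)) (X (Suc (Suc l)))" by (rule Comp_in_Hom[OF i d'H])
      have "g \<cdot> d' \<cdot> ?i = k \<cdot> (\<pi> (Suc (Suc l)) (K, Suc p) \<cdot> (d' \<cdot> ?i))"
        using Comp_assoc[OF i d'H g] Comp_assoc[OF di proj_Hom[OF Kp] k(1)] by (simp add: g_def)
      also have "\<dots> = f \<cdot> ?i"
      proof (cases "m = K")
        case True
        then have "q = p" using mq p by simp
        then show ?thesis using triangularD(3)[OF d' p] True k(2) by (simp add: h_def)
      next
        case False
        then have "K < m" using m by simp
        then show ?thesis
          using triangularD(2)[OF d' mq Kp] Comp_Zero_right[OF k(1) J_Obj] Suc.prems(3)[OF mq]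
          by simp
      qed
      finally have "f' \<cdot> ?i \<boxplus> f \<cdot> ?i = f \<cdot> ?i"
        using Comp_Add_left[OF i f'(1) gd] f'(2) by simp
      then show ?thesis
        using Add_cancel[OF Comp_in_Hom[OF i f'(1)] Comp_in_Hom[OF i Suc.prems(1)]] by simp
    qed
    obtain x where x: "x \<in> Hom C (X (Suc (Suc l))) Q" "x \<cdot> d' = f'"
      and xv: "\<And>m q. m + q + 2 = Suc (Suc l) \<Longrightarrow> K \<le> m \<Longrightarrow>
        x \<cdot> \<iota> (Suc (Suc l)) (m, q) = Zero C (J (m, q)) Q"
      using Suc.IH[OF f'(1) f'd f'v] by blast
    have "(x \<boxplus> g) \<cdot> d' = f" using Comp_Add_left[OF d'H x(1) g] x(2) f'(2) by simp
    moreover have "(x \<boxplus> g) \<cdot> \<iota> (Suc (Suc l)) (m, q) = Zero C (J (m, q)) Q"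
      if mq: "m + q + 2 = Suc (Suc l)" and m: "Suc K \<le> m" for m q
    proof -
      note i = inj_Hom[OF mq]
      have "\<pi> (Suc (Suc l)) (K, Suc p) \<cdot> \<iota> (Suc (Suc l)) (m, q) = Zero C (J (m, q)) (J (K, Suc p))"
        using direct_sumD(7)[OF sum, of "(m, q)" "Suc (Suc l)" "(K, Suc p)"] mq m Kp by simp
      then have "g \<cdot> \<iota> (Suc (Suc l)) (m, q) = Zero C (J (m, q)) Q"
        using Comp_assoc[OF i proj_Hom[OF Kp] k(1)] Comp_Zero_right[OF k(1) J_Obj] by (simp add: g_def)
      then show ?thesis
        using Comp_Add_left[OF i x(1) g] xv[OF mq] m Add_Zero(1)[OF Zero_in_Hom[OF J_Obj Qo]] by simp
    qed
    ultimately show ?thesis using Add_in_Hom[OF x(1) g] by blast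
  qed
qed

text \<open>The rows with target in \<open>M\<close> need no correction: the bottom row of \<open>d\<close> is \<open>\<tau>\<close>, and
  \<open>\<tau>\<close> squares to zero.\<close>

lemma row_into_complex:
  assumes d: "triangular l d" and l: "m' + 0 + 2 = Suc (Suc l)"
  shows "\<exists>e \<in> Hom C (X (Suc l)) (J (m', 0)). e \<cdot> d = Zero C (X l) (J (m', 0)) \<and>
    (\<forall>m p. m + p + 2 = Suc l \<longrightarrow> e \<cdot> \<iota> (Suc l) (m, p) =
       (if p = 0 then \<tau> m else Zero C (J (m, p)) (J (m', 0))))"
proof -
  note dH = triangularD(1)[OF d]
  let ?f = "\<lambda>(m, p). if p = 0 then \<tau> m else Zero C (J (m, p)) (J (m', 0))"
  have "?f j \<in> Hom C (J j) (J (m', 0))" if "j \<in> diagonal (Suc l)" for j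
  proof -
    obtain m p where j: "j = (m, p)" by (cases j)
    have "m' = Suc m" if "p = 0" using \<open>j \<in> diagonal (Suc l)\<close> j l that by simp
    then show ?thesis using j row[of m] Zero_in_Hom[OF J_Obj J_Obj] by auto
  qed
  then obtain e where e: "e \<in> Hom C (X (Suc l)) (J (m', 0))"
    and ei: "\<forall>j \<in> diagonal (Suc l). e \<cdot> \<iota> (Suc l) j = ?f j"
    using arrow_from_sum[OF sum J_Obj, of "Suc l" ?f] by blast
  have ei': "e \<cdot> \<iota> (Suc l) (m, p) = (if p = 0 then \<tau> m else Zero C (J (m, p)) (J (m', 0)))"
    if "m + p + 2 = Suc l" for m p
    using ei that by fastforce
  have "e \<cdot> d = Zero C (X l) (J (m', 0))"
  proof (rule eq_on_summands[OF sum Comp_in_Hom[OF dH e] Zero_in_Hom[OF X_Obj J_Obj]])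
    fix i assume "i \<in> diagonal l"
    then obtain m p where i: "i = (m, p)" and mp: "m + p + 2 = l" by (cases i) auto
    obtain n where n: "m' = Suc n" using mp l by (cases m') auto
    have n0: "n + 0 + 2 = Suc l" using n l by simp
    note iH = inj_Hom[OF mp]
    have "e \<cdot> (d \<cdot> \<iota> l (m, p)) =
        (e \<cdot> \<iota> (Suc l) (n, 0)) \<cdot> (\<pi> (Suc l) (n, 0) \<cdot> (d \<cdot> \<iota> l (m, p)))"
    proof (rule Comp_single_summand[OF sum e Comp_in_Hom[OF iH dH]])
      fix j assume j: "j \<in> diagonal (Suc l)" "j \<noteq> (n, 0)"
      then obtain a b where ab: "j = (a, b)" "a + b + 2 = Suc l" by (cases j) auto
      with j(2) n0 have "b \<noteq> 0" by auto
      then show "e \<cdot> \<iota> (Suc l) j = Zero C (J j) (J (m', 0)) \<or>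
          \<pi> (Suc l) j \<cdot> (d \<cdot> \<iota> l (m, p)) = Zero C (J (m, p)) (J j)"
        using ei'[OF ab(2)] ab(1) by simp
    qed (use n0 in simp)
    also have "\<dots> = \<tau> n \<cdot> (\<pi> (Suc l) (n, 0) \<cdot> (d \<cdot> \<iota> l (m, p)))" using ei'[OF n0] by simp
    also have "\<dots> = Zero C (J (m, p)) (J (m', 0))"
    proof (cases p)
      case 0
      then have "n = Suc m" using mp n0 by simp
      then show ?thesis using triangularD(4)[OF d] mp 0 row_square[of m] n by simp
    next
      case (Suc p')
      then show ?thesis using triangularD(5)[OF d _ n0] mp Comp_Zero_right[OF row[of n] J_Obj] n by simp
    qed
    finally show "e \<cdot> d \<cdot> \<iota> l i = Zero C (X l) (J (m', 0)) \<cdot> \<iota> l i"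
      using Comp_assoc[OF iH dH e] Comp_Zero_left[OF iH J_Obj] i by simp
  qed
  then show ?thesis using e ei' by blast
qed

text \<open>
  The vertical differential \<open>e\<close> alone fails to annihilate \<open>d\<close>, but \<open>e \<cdot> d\<close> vanishes on the
  columns from \<open>m'\<close> on, since the columns are complexes.  Hence \<open>- e \<cdot> d\<close> extends along \<open>d\<close> to
  an arrow that vanishes on these columns, and adding it to \<open>e\<close> changes only the components from
  the columns before \<open>m'\<close>, which are unconstrained.
\<close>

lemma row_into_injective:
  assumes c: "triangular l c" and d: "triangular (Suc l) d"
    and dc: "d \<cdot> c = Zero C (X l) (X (Suc (Suc l)))"
    and l: "m' + Suc p' + 2 = Suc (Suc (Suc l))"
  shows "\<exists>e \<in> Hom C (X (Suc (Suc l))) (J (m', Suc p')).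
    e \<cdot> d = Zero C (X (Suc l)) (J (m', Suc p')) \<and>
    (\<forall>m p. m + p + 2 = Suc (Suc l) \<longrightarrow> m' \<le> m \<longrightarrow> e \<cdot> \<iota> (Suc (Suc l)) (m, p) =
       (if m = m' then \<epsilon> m p else Zero C (J (m, p)) (J (m', Suc p'))))"
proof -
  let ?Q = "J (m', Suc p')"
  note cH = triangularD(1)[OF c] and dH = triangularD(1)[OF d]
  have l': "m' + p' + 2 = Suc (Suc l)" using l by simp
  define e where "e = \<epsilon> m' p' \<cdot> \<pi> (Suc (Suc l)) (m', p')"
  have e: "e \<in> Hom C (X (Suc (Suc l))) ?Q"
    unfolding e_def by (rule Comp_in_Hom[OF proj_Hom[OF l'] column])
  have ei: "e \<cdot> \<iota> (Suc (Suc l)) (m, p) =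
      (if m = m' then \<epsilon> m p else Zero C (J (m, p)) ?Q)" if mp: "m + p + 2 = Suc (Suc l)" for m p
  proof -
    have "e \<cdot> \<iota> (Suc (Suc l)) (m, p) =
        \<epsilon> m' p' \<cdot> (\<pi> (Suc (Suc l)) (m', p') \<cdot> \<iota> (Suc (Suc l)) (m, p))"
      unfolding e_def by (rule Comp_assoc[OF inj_Hom[OF mp] proj_Hom[OF l'] column])
    also have "\<dots> = (if m = m' then \<epsilon> m p else Zero C (J (m, p)) ?Q)"
    proof (cases "m = m'")
      case True
      then have "p = p'" using mp l' by simp
      then show ?thesis
        using True direct_sumD(6)[OF sum, of "(m', p')" "Suc (Suc l)"] l' Comp_Ide_right[OF column]
        by simp
    next
      case False
      then show ?thesis
        using direct_sumD(7)[OF sum, of "(m, p)" "Suc (Suc l)" "(m', p')"] mp l'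
          Comp_Zero_right[OF column J_Obj] by simp
    qed
    finally show ?thesis .
  qed
  have ed: "e \<cdot> d \<in> Hom C (X (Suc l)) ?Q" by (rule Comp_in_Hom[OF dH e])
  have edv: "e \<cdot> d \<cdot> \<iota> (Suc l) (m, p) = Zero C (J (m, p)) ?Q"
    if mp: "m + p + 2 = Suc l" and m: "m' \<le> m" for m p
  proof -
    note i = inj_Hom[OF mp]
    have "e \<cdot> d \<cdot> \<iota> (Suc l) (m, p) =
        \<epsilon> m' p' \<cdot> (\<pi> (Suc (Suc l)) (m', p') \<cdot> (d \<cdot> \<iota> (Suc l) (m, p)))"
      using Comp_assoc[OF i dH e] Comp_assoc[OF Comp_in_Hom[OF i dH] proj_Hom[OF l'] column]
      by (simp add: e_def)
    also have "\<dots> = Zero C (J (m, p)) ?Q"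
    proof (cases "m = m'")
      case True
      then have "p' = Suc p" using mp l' by simp
      then show ?thesis using triangularD(3)[OF d mp] True column_square[of m p] by simp
    next
      case False
      then have "m' < m" using m by simp
      then show ?thesis using triangularD(2)[OF d mp l'] Comp_Zero_right[OF column J_Obj] by simp
    qed
    finally show ?thesis .
  qed
  have z: "Zero C (X (Suc l)) ?Q \<in> Hom C (X (Suc l)) ?Q" by (rule Zero_in_Hom[OF X_Obj J_Obj])
  obtain f where f: "f \<in> Hom C (X (Suc l)) ?Q" "f \<boxplus> e \<cdot> d = Zero C (X (Suc l)) ?Q"
    using difference_exists[OF z ed] by blast
  have fc: "f \<cdot> c = Zero C (X l) ?Q"
  proof -
    have "e \<cdot> d \<cdot> c = Zero C (X l) ?Q"
      using Comp_assoc[OF cH dH e] dc Comp_Zero_right[OF e X_Obj] by simp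
    then show ?thesis
      using Comp_Add_left[OF cH f(1) ed] f(2) Add_Zero(1)[OF Comp_in_Hom[OF cH f(1)]]
        Comp_Zero_left[OF cH J_Obj] by simp
  qed
  have fv: "f \<cdot> \<iota> (Suc l) (m, p) = Zero C (J (m, p)) ?Q"
    if mp: "m + p + 2 = Suc l" and m: "m' \<le> m" for m p
    using Comp_Add_left[OF inj_Hom[OF mp] f(1) ed] f(2) edv[OF mp m]
      Add_Zero(1)[OF Comp_in_Hom[OF inj_Hom[OF mp] f(1)]] Comp_Zero_left[OF inj_Hom[OF mp] J_Obj]
    by simp
  obtain x where x: "x \<in> Hom C (X (Suc (Suc l))) ?Q" "x \<cdot> d = f"
    and xv: "\<forall>m p. m + p + 2 = Suc (Suc l) \<longrightarrow> m' \<le> m \<longrightarrow>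
       x \<cdot> \<iota> (Suc (Suc l)) (m, p) = Zero C (J (m, p)) ?Q"
    using filtered_exact[OF c d dc injective_above f(1) fc fv] by blast
  have "(x \<boxplus> e) \<cdot> d = Zero C (X (Suc l)) ?Q"
    using Comp_Add_left[OF dH x(1) e] x(2) f(2) by simp
  moreover have "(x \<boxplus> e) \<cdot> \<iota> (Suc (Suc l)) (m, p) =
       (if m = m' then \<epsilon> m p else Zero C (J (m, p)) ?Q)"
    if mp: "m + p + 2 = Suc (Suc l)" and m: "m' \<le> m" for m p
    using Comp_Add_left[OF inj_Hom[OF mp] x(1) e] xv mp m
      Add_Zero(2)[OF Comp_in_Hom[OF inj_Hom[OF mp] e]] ei[OF mp] by simp
  ultimately show ?thesis using Add_in_Hom[OF x(1) e] by blast
qed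

lemma next_differential:
  assumes c: "triangular l c" and d: "triangular (Suc l) d"
    and dc: "d \<cdot> c = Zero C (X l) (X (Suc (Suc l)))"
  shows "\<exists>b. triangular (Suc (Suc l)) b \<and> b \<cdot> d = Zero C (X (Suc l)) (X (Suc (Suc (Suc l))))"
proof -
  let ?n = "Suc (Suc l)"
  note dH = triangularD(1)[OF d]
  let ?P = "\<lambda>j e. e \<in> Hom C (X ?n) (J j) \<and> e \<cdot> d = Zero C (X (Suc l)) (J j) \<and>
    (\<forall>m p. m + p + 2 = ?n \<longrightarrow>
       (fst j < m \<longrightarrow> e \<cdot> \<iota> ?n (m, p) = Zero C (J (m, p)) (J j)) \<and>
       (fst j = m \<longrightarrow> e \<cdot> \<iota> ?n (m, p) = \<epsilon> m p) \<and>
       (snd j = 0 \<longrightarrow> e \<cdot> \<iota> ?n (m, p) = (if p = 0 then \<tau> m else Zero C (J (m, p)) (J j))))"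
  have "\<exists>e. ?P j e" if "j \<in> diagonal (Suc ?n)" for j
  proof -
    obtain m' p' where j': "j = (m', p')" by (cases j)
    with that have j: "j = (m', p')" "m' + p' + 2 = Suc ?n" by simp_all
    show ?thesis
    proof (cases p')
      case 0
      then have "m' + 0 + 2 = Suc ?n" using j by simp
      from row_into_complex[OF d this] obtain e where
        "e \<in> Hom C (X ?n) (J (m', 0))" "e \<cdot> d = Zero C (X (Suc l)) (J (m', 0))"
        "\<forall>m p. m + p + 2 = ?n \<longrightarrow> e \<cdot> \<iota> ?n (m, p) = (if p = 0 then \<tau> m else Zero C (J (m, p)) (J (m', 0)))"
        by blast
      then show ?thesis using j 0 by (intro exI[of _ e]) auto
    next
      case (Suc p'')
      then have "m' + Suc p'' + 2 = Suc ?n" using j by simp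
      from row_into_injective[OF c d dc this] obtain e where
        "e \<in> Hom C (X ?n) (J (m', Suc p''))" "e \<cdot> d = Zero C (X (Suc l)) (J (m', Suc p''))"
        "\<forall>m p. m + p + 2 = ?n \<longrightarrow> m' \<le> m \<longrightarrow> e \<cdot> \<iota> ?n (m, p) =
           (if m = m' then \<epsilon> m p else Zero C (J (m, p)) (J (m', Suc p'')))"
        by blast
      then show ?thesis using j Suc by (intro exI[of _ e]) auto
    qed
  qed
  then have "\<forall>j \<in> diagonal (Suc ?n). \<exists>e. ?P j e" by blast
  from bchoice[OF this] obtain e where e: "\<And>j. j \<in> diagonal (Suc ?n) \<Longrightarrow> ?P j (e j)" by blast
  obtain b where b: "b \<in> Hom C (X ?n) (X (Suc ?n))"
    and be: "\<forall>j \<in> diagonal (Suc ?n). \<pi> (Suc ?n) j \<cdot> b = e j"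
    using arrow_into_sum[OF sum X_Obj, of "Suc ?n" e] e by blast
  have "triangular ?n b"
  proof -
    have comp: "component ?n b (m, p) (m', p') = e (m', p') \<cdot> \<iota> ?n (m, p)"
      if "m + p + 2 = ?n" "m' + p' + 2 = Suc ?n" for m p m' p'
      using Comp_assoc[OF inj_Hom[OF that(1)] b proj_Hom[OF that(2)]] be that
      by (simp add: component_def)
    show ?thesis
      unfolding triangular_def
    proof (intro conjI allI impI, goal_cases)
      case 1
      show ?case by (rule b)
    next
      case (2 m p m' p')
      then show ?case using comp[of m p m' p'] e[of "(m', p')"] by simp
    next
      case (3 m p m' p')
      then show ?case using comp[of m p m' p'] e[of "(m', p')"] by simp
    next
      case (4 m p m' p')
      then show ?case using comp[of m p m' p'] e[of "(m', p')"] by simp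
    qed
  qed
  moreover have "b \<cdot> d = Zero C (X (Suc l)) (X (Suc ?n))"
  proof (rule eq_on_projections[OF sum Comp_in_Hom[OF dH b] Zero_in_Hom[OF X_Obj X_Obj]])
    fix j assume j: "j \<in> diagonal (Suc ?n)"
    note pj = direct_sumD(4)[OF sum j]
    show "\<pi> (Suc ?n) j \<cdot> (b \<cdot> d) = \<pi> (Suc ?n) j \<cdot> Zero C (X (Suc l)) (X (Suc ?n))"
      using Comp_assoc[OF dH b pj] be e j Comp_Zero_right[OF pj X_Obj] by simp
  qed
  ultimately show ?thesis by blast
qed

text \<open>The recursion carries two successive differentials, because the next one is built using
  that the composite of the last two vanishes.\<close>

lemma total_differential_exists:
  "\<exists>d. \<forall>l. triangular l (d l) \<and> d (Suc l) \<cdot> d l = Zero C (X l) (X (Suc (Suc l)))"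
proof -
  let ?P = "\<lambda>l x. triangular l (fst x) \<and> triangular (Suc l) (snd x) \<and>
    snd x \<cdot> fst x = Zero C (X l) (X (Suc (Suc l)))"
  let ?R = "\<lambda>(l :: nat) (x :: 'm \<times> 'm) (y :: 'm \<times> 'm). fst y = snd x"
  have z: "Zero C (X l) (X l') \<in> Hom C (X l) (X l')" for l l' by (rule Zero_in_Hom[OF X_Obj X_Obj])
  have base: "\<exists>x. ?P 0 x"
    by (rule exI[of _ "(Zero C (X 0) (X 1), Zero C (X 1) (X 2))"])
      (use z Comp_Zero_left[OF z X_Obj] in \<open>simp add: triangular_def numeral_2_eq_2\<close>)
  have step: "\<exists>y. ?P (Suc l) y \<and> ?R l x y" if P: "?P l x" for x l
  proof -
    obtain b where "triangular (Suc (Suc l)) b"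
        "b \<cdot> snd x = Zero C (X (Suc l)) (X (Suc (Suc (Suc l))))"
      using next_differential[of l "fst x" "snd x"] P by blast
    with P show ?thesis by (intro exI[of _ "(snd x, b)"]) simp
  qed
  have "\<exists>x. \<forall>l. ?P l (x l) \<and> ?R l (x l) (x (Suc l))"
    using base step by (rule dependent_nat_choice[of ?P ?R])
  then obtain x where x: "\<forall>l. ?P l (x l) \<and> ?R l (x l) (x (Suc l))" by blast
  show ?thesis
  proof (intro exI[of _ "\<lambda>l. fst (x l)"] allI)
    fix l
    show "triangular l (fst (x l)) \<and>
        fst (x (Suc l)) \<cdot> fst (x l) = Zero C (X l) (X (Suc (Suc l)))"
      using x[rule_format, of l] by simp
  qed
qed

text \<open>The subcomplex above the bottom row has terms \<open>S\<^sup>l\<close>, a summand of \<open>X (l + 3)\<close> whose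
  complement is \<open>M\<^sup>l\<^sup>+\<^sup>1\<close>.\<close>

lemma inclusion_and_retraction:
  assumes S: "is_direct_sum C {(m, n). m + n = l} (\<lambda>(m, n). J (m, Suc n)) S \<iota>' \<pi>'"
  shows "\<exists>j q. j \<in> Hom C S (X (Suc (Suc (Suc l)))) \<and> q \<in> Hom C (X (Suc (Suc (Suc l)))) S \<and>
    (\<forall>m n. m + n = l \<longrightarrow> j \<cdot> \<iota>' (m, n) = \<iota> (Suc (Suc (Suc l))) (m, Suc n)) \<and>
    (\<forall>m n. m + n = l \<longrightarrow> q \<cdot> \<iota> (Suc (Suc (Suc l))) (m, Suc n) = \<iota>' (m, n)) \<and>
    q \<cdot> \<iota> (Suc (Suc (Suc l))) (Suc l, 0) = Zero C (J (Suc l, 0)) S"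
proof -
  let ?f = "\<lambda>(m, n). \<iota> (Suc (Suc (Suc l))) (m, Suc n)"
  let ?g = "\<lambda>(m, p). case p of 0 \<Rightarrow> Zero C (J (m, 0)) S | Suc n \<Rightarrow> \<iota>' (m, n)"
  have So: "S \<in> Obj C" by (rule direct_sumD(2)[OF S])
  have f: "?f i \<in> Hom C ((\<lambda>(m, n). J (m, Suc n)) i) (X (Suc (Suc (Suc l))))"
    if "i \<in> {(m, n). m + n = l}" for i
    using that inj_Hom[of _ "Suc _" "Suc (Suc (Suc l))"] by auto
  have g: "?g i \<in> Hom C (J i) S" if i: "i \<in> diagonal (Suc (Suc (Suc l)))" for i
  proof -
    obtain m p where mp: "i = (m, p)" by (cases i)
    show ?thesis
    proof (cases p)
      case 0
      then show ?thesis using mp Zero_in_Hom[OF J_Obj So] by simp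
    next
      case (Suc n)
      then show ?thesis using i mp direct_sumD(3)[OF S, of "(m, n)"] by simp
    qed
  qed
  obtain j where "j \<in> Hom C S (X (Suc (Suc (Suc l))))" "\<forall>i \<in> {(m, n). m + n = l}. j \<cdot> \<iota>' i = ?f i"
    using arrow_from_sum[OF S X_Obj f] by blast
  moreover obtain q where "q \<in> Hom C (X (Suc (Suc (Suc l)))) S"
    and q: "\<forall>i \<in> diagonal (Suc (Suc (Suc l))). q \<cdot> \<iota> (Suc (Suc (Suc l))) i = ?g i"
    using arrow_from_sum[OF sum So g] by blast
  moreover have "q \<cdot> \<iota> (Suc (Suc (Suc l))) (m, Suc n) = \<iota>' (m, n)" if "m + n = l" for m n
    using q[rule_format, of "(m, Suc n)"] that by simp
  moreover have "q \<cdot> \<iota> (Suc (Suc (Suc l))) (Suc l, 0) = Zero C (J (Suc l, 0)) S"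
    using q[rule_format, of "(Suc l, 0)"] by simp
  ultimately show ?thesis by (intro exI[of _ j] exI[of _ q]) simp
qed


end


section \<open>The subcomplex of injective objects\<close>

text \<open>
  The objects \<open>S l\<close> collect the part of \<open>X (l + 3)\<close> above the bottom row, with inclusion \<open>j\<close> and
  retraction \<open>q\<close>.  The arrow \<open>\<kappa>\<close> makes the bottom row an exact complex
  \<open>A \<rightarrow> M\<^sup>0 \<rightarrow> M\<^sup>1 \<rightarrow> \<dots>\<close> from \<open>M\<^sup>0\<close> on.
\<close>

locale resolved_subcomplex = resolved_complex C J \<epsilon> \<tau> X \<iota> \<pi>
  for C :: "('o, 'm, 'r) preadditive_category_scheme" (structure)
    and J \<epsilon> \<tau> X \<iota> \<pi> +
  fixes d :: "nat \<Rightarrow> 'm" and A :: 'o and \<kappa> :: 'm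
    and S :: "nat \<Rightarrow> 'o" and \<iota>' :: "nat \<Rightarrow> nat \<times> nat \<Rightarrow> 'm" and \<pi>' :: "nat \<Rightarrow> nat \<times> nat \<Rightarrow> 'm"
    and j :: "nat \<Rightarrow> 'm" and q :: "nat \<Rightarrow> 'm"
  assumes d_triangular: "triangular l (d l)"
    and d_square: "d (Suc l) \<cdot> d l = Zero C (X l) (X (Suc (Suc l)))"
    and augmentation: "\<kappa> \<in> Hom C A (J (0, 0))" "\<tau> 0 \<cdot> \<kappa> = Zero C A (J (1, 0))"
    and row_exact_0: "hom_exact C A (J (0, 0)) (J (1, 0)) \<kappa> (\<tau> 0)"
    and row_exact_Suc: "hom_exact C (J (l, 0)) (J (Suc l, 0)) (J (Suc (Suc l), 0)) (\<tau> l) (\<tau> (Suc l))"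
    and S_sum: "is_direct_sum C {(m, n). m + n = l} (\<lambda>(m, n). J (m, Suc n)) (S l) (\<iota>' l) (\<pi>' l)"
    and j_Hom: "j l \<in> Hom C (S l) (X (Suc (Suc (Suc l))))"
    and q_Hom: "q l \<in> Hom C (X (Suc (Suc (Suc l)))) (S l)"
    and j_inj: "m + n = l \<Longrightarrow> j l \<cdot> \<iota>' l (m, n) = \<iota> (Suc (Suc (Suc l))) (m, Suc n)"
    and q_inj: "m + n = l \<Longrightarrow> q l \<cdot> \<iota> (Suc (Suc (Suc l))) (m, Suc n) = \<iota>' l (m, n)"
    and q_inj_0: "q l \<cdot> \<iota> (Suc (Suc (Suc l))) (Suc l, 0) = Zero C (J (Suc l, 0)) (S l)"
begin

abbreviation Y :: "nat \<Rightarrow> 'o" where "Y l \<equiv> X (Suc (Suc (Suc l)))"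

lemma d_Hom: "d l \<in> Hom C (X l) (X (Suc l))"
  by (rule triangularD(1)[OF d_triangular])

lemma S_Obj: "S l \<in> Obj C"
  by (rule direct_sumD(2)[OF S_sum])

lemma inj'_Hom: "m + n = l \<Longrightarrow> \<iota>' l (m, n) \<in> Hom C (J (m, Suc n)) (S l)"
  and proj'_Hom: "m + n = l \<Longrightarrow> \<pi>' l (m, n) \<in> Hom C (S l) (J (m, Suc n))"
  using direct_sumD(3,4)[OF S_sum, of "(m, n)" l] by auto

lemma q_j: "q l \<cdot> j l = Ide C (S l)"
proof (rule eq_on_summands[OF S_sum Comp_in_Hom[OF j_Hom q_Hom] Ide_in_Hom[OF S_Obj]])
  fix i assume "i \<in> {(m, n). m + n = l}"
  then obtain m n where i: "i = (m, n)" "m + n = l" by auto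
  show "q l \<cdot> j l \<cdot> \<iota>' l i = Ide C (S l) \<cdot> \<iota>' l i"
    using Comp_assoc[OF inj'_Hom[OF i(2)] j_Hom q_Hom] j_inj[OF i(2)] q_inj[OF i(2)]
      Comp_Ide_left[OF inj'_Hom[OF i(2)]] i(1) by simp
qed

lemma proj_j:
  assumes mn: "m + n = l"
  shows "\<pi> (Suc (Suc (Suc l))) (m, Suc n) \<cdot> j l = \<pi>' l (m, n)"
proof -
  have p: "m + Suc n + 2 = Suc (Suc (Suc l))" using mn by simp
  show ?thesis
  proof (rule eq_on_summands[OF S_sum Comp_in_Hom[OF j_Hom proj_Hom[OF p]] proj'_Hom[OF mn]])
    fix i assume "i \<in> {(m, n). m + n = l}"
    then obtain a b where i: "i = (a, b)" "a + b = l" by auto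
    have "\<pi> (Suc (Suc (Suc l))) (m, Suc n) \<cdot> \<iota> (Suc (Suc (Suc l))) (a, Suc b) =
        \<pi>' l (m, n) \<cdot> \<iota>' l (a, b)"
      using direct_sumD(6,7)[OF sum, of "(m, Suc n)"] direct_sumD(7)[OF sum, of "(a, Suc b)" _ "(m, Suc n)"]
        direct_sumD(6,7)[OF S_sum, of "(m, n)" l] direct_sumD(7)[OF S_sum, of "(a, b)" l "(m, n)"] p i(2) mn
      by (cases "(a, b) = (m, n)") auto
    then show "\<pi> (Suc (Suc (Suc l))) (m, Suc n) \<cdot> j l \<cdot> \<iota>' l i = \<pi>' l (m, n) \<cdot> \<iota>' l i"
      using Comp_assoc[OF inj'_Hom[OF i(2)] j_Hom proj_Hom[OF p]] j_inj[OF i(2)] i(1) by simp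
  qed
qed

lemma proj_j_0: "\<pi> (Suc (Suc (Suc l))) (Suc l, 0) \<cdot> j l = Zero C (S l) (J (Suc l, 0))"
proof -
  have p: "Suc l + 0 + 2 = Suc (Suc (Suc l))" by simp
  show ?thesis
  proof (rule eq_on_summands[OF S_sum Comp_in_Hom[OF j_Hom proj_Hom[OF p]] Zero_in_Hom[OF S_Obj J_Obj]])
    fix i assume "i \<in> {(m, n). m + n = l}"
    then obtain a b where i: "i = (a, b)" "a + b = l" by auto
    have "\<pi> (Suc (Suc (Suc l))) (Suc l, 0) \<cdot> \<iota> (Suc (Suc (Suc l))) (a, Suc b) =
        Zero C (J (a, Suc b)) (J (Suc l, 0))"
      using direct_sumD(7)[OF sum, of "(a, Suc b)" _ "(Suc l, 0)"] i(2) by simp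
    then show "\<pi> (Suc (Suc (Suc l))) (Suc l, 0) \<cdot> j l \<cdot> \<iota>' l i =
        Zero C (S l) (J (Suc l, 0)) \<cdot> \<iota>' l i"
      using Comp_assoc[OF inj'_Hom[OF i(2)] j_Hom proj_Hom[OF p]] j_inj[OF i(2)] i(1)
        Comp_Zero_left[OF inj'_Hom[OF i(2)] J_Obj] by simp
  qed
qed

lemma proj_q:
  assumes mn: "m + n = l"
  shows "\<pi>' l (m, n) \<cdot> q l = \<pi> (Suc (Suc (Suc l))) (m, Suc n)"
proof -
  have p: "m + Suc n + 2 = Suc (Suc (Suc l))" using mn by simp
  show ?thesis
  proof (rule eq_on_summands[OF sum Comp_in_Hom[OF q_Hom proj'_Hom[OF mn]] proj_Hom[OF p]])
    fix i assume "i \<in> diagonal (Suc (Suc (Suc l)))"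
    then obtain a b where i: "i = (a, b)" "a + b + 2 = Suc (Suc (Suc l))" by (cases i) auto
    have "\<pi>' l (m, n) \<cdot> (q l \<cdot> \<iota> (Suc (Suc (Suc l))) (a, b)) =
        \<pi> (Suc (Suc (Suc l))) (m, Suc n) \<cdot> \<iota> (Suc (Suc (Suc l))) (a, b)"
    proof (cases b)
      case 0
      then have "a = Suc l" using i(2) by simp
      then show ?thesis
        using q_inj_0 Comp_Zero_right[OF proj'_Hom[OF mn] J_Obj] 0
          direct_sumD(7)[OF sum, of "(Suc l, 0)" _ "(m, Suc n)"] p by simp
    next
      case (Suc b')
      then have ab: "a + b' = l" using i(2) by simp
      have "\<pi>' l (m, n) \<cdot> \<iota>' l (a, b') =
          \<pi> (Suc (Suc (Suc l))) (m, Suc n) \<cdot> \<iota> (Suc (Suc (Suc l))) (a, Suc b')"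
        using direct_sumD(6)[OF sum, of "(m, Suc n)"] direct_sumD(7)[OF sum, of "(a, Suc b')" _ "(m, Suc n)"]
          direct_sumD(6)[OF S_sum, of "(m, n)" l] direct_sumD(7)[OF S_sum, of "(a, b')" l "(m, n)"] p ab mn
        by (cases "(a, b') = (m, n)") auto
      then show ?thesis using q_inj[OF ab] Suc by simp
    qed
    then show "\<pi>' l (m, n) \<cdot> q l \<cdot> \<iota> (Suc (Suc (Suc l))) i =
        \<pi> (Suc (Suc (Suc l))) (m, Suc n) \<cdot> \<iota> (Suc (Suc (Suc l))) i"
      using Comp_assoc[OF inj_Hom[OF i(2)] q_Hom proj'_Hom[OF mn]] i(1) by simp
  qed
qed

definition D :: "nat \<Rightarrow> 'm" where
  "D l = q (Suc l) \<cdot> (d (Suc (Suc (Suc l))) \<cdot> j l)"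

lemma dj_Hom: "d (Suc (Suc (Suc l))) \<cdot> j l \<in> Hom C (S l) (Y (Suc l))"
  by (rule Comp_in_Hom[OF j_Hom d_Hom])

lemma D_Hom: "D l \<in> Hom C (S l) (S (Suc l))"
  unfolding D_def by (rule Comp_in_Hom[OF dj_Hom q_Hom])

lemma proj_d_j_0:
  "\<pi> (Suc (Suc (Suc (Suc l)))) (Suc (Suc l), 0) \<cdot> (d (Suc (Suc (Suc l))) \<cdot> j l) =
     Zero C (S l) (J (Suc (Suc l), 0))"
proof -
  have p: "Suc (Suc l) + 0 + 2 = Suc (Suc (Suc (Suc l)))" by simp
  show ?thesis
  proof (rule eq_on_summands[OF S_sum Comp_in_Hom[OF dj_Hom proj_Hom[OF p]] Zero_in_Hom[OF S_Obj J_Obj]])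
    fix i assume "i \<in> {(m, n). m + n = l}"
    then obtain a b where i: "i = (a, b)" "a + b = l" by auto
    have ab: "a + Suc b + 2 = Suc (Suc (Suc l))" using i by simp
    show "\<pi> (Suc (Suc (Suc (Suc l)))) (Suc (Suc l), 0) \<cdot> (d (Suc (Suc (Suc l))) \<cdot> j l) \<cdot> \<iota>' l i =
        Zero C (S l) (J (Suc (Suc l), 0)) \<cdot> \<iota>' l i"
      using Comp_assoc[OF inj'_Hom[OF i(2)] dj_Hom proj_Hom[OF p]]
        Comp_assoc[OF inj'_Hom[OF i(2)] j_Hom d_Hom] j_inj[OF i(2)]
        triangularD(5)[OF d_triangular ab p] Comp_Zero_left[OF inj'_Hom[OF i(2)] J_Obj] i(1) by simp
  qed
qed

text \<open>The inclusion \<open>j\<close> is a chain map, as \<open>d\<close> does not lead from \<open>S\<close> to the bottom row.\<close>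

lemma d_j: "d (Suc (Suc (Suc l))) \<cdot> j l = j (Suc l) \<cdot> D l"
proof (rule eq_on_projections[OF sum dj_Hom Comp_in_Hom[OF D_Hom j_Hom]])
  fix i assume "i \<in> diagonal (Suc (Suc (Suc (Suc l))))"
  then obtain a b where i: "i = (a, b)" "a + b + 2 = Suc (Suc (Suc (Suc l)))" by (cases i) auto
  have "\<pi> (Suc (Suc (Suc (Suc l)))) (a, b) \<cdot> (d (Suc (Suc (Suc l))) \<cdot> j l) =
      \<pi> (Suc (Suc (Suc (Suc l)))) (a, b) \<cdot> j (Suc l) \<cdot> D l"
  proof (cases b)
    case 0
    then have "a = Suc (Suc l)" using i(2) by simp
    then show ?thesis
      using 0 proj_d_j_0 proj_j_0[of "Suc l"] Comp_Zero_left[OF D_Hom J_Obj] by simp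
  next
    case (Suc b')
    then have ab: "a + b' = Suc l" using i(2) by simp
    show ?thesis
      using proj_j[OF ab] proj_q[OF ab] Comp_assoc[OF dj_Hom q_Hom proj'_Hom[OF ab]] Suc
      by (simp add: D_def)
  qed
  then show "\<pi> (Suc (Suc (Suc (Suc l)))) i \<cdot> (d (Suc (Suc (Suc l))) \<cdot> j l) =
      \<pi> (Suc (Suc (Suc (Suc l)))) i \<cdot> (j (Suc l) \<cdot> D l)"
    using Comp_assoc[OF D_Hom j_Hom proj_Hom[OF i(2)]] i(1) by simp
qed

lemma D_square: "D (Suc l) \<cdot> D l = Zero C (S l) (S (Suc (Suc l)))"
proof -
  have "D (Suc l) \<cdot> D l = q (Suc (Suc l)) \<cdot> (d (Suc (Suc (Suc (Suc l)))) \<cdot> j (Suc l) \<cdot> D l)"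
    unfolding D_def[of "Suc l"] by (rule Comp_assoc[OF D_Hom dj_Hom q_Hom])
  also have "d (Suc (Suc (Suc (Suc l)))) \<cdot> j (Suc l) \<cdot> D l =
      d (Suc (Suc (Suc (Suc l)))) \<cdot> (d (Suc (Suc (Suc l))) \<cdot> j l)"
    using Comp_assoc[OF D_Hom j_Hom d_Hom] d_j by simp
  also have "\<dots> = Zero C (S l) (Y (Suc (Suc l)))"
    using Comp_assoc[OF j_Hom d_Hom d_Hom] d_square Comp_Zero_left[OF j_Hom X_Obj] by metis
  also have "q (Suc (Suc l)) \<cdot> \<dots> = Zero C (S l) (S (Suc (Suc l)))"
    by (rule Comp_Zero_right[OF q_Hom S_Obj])
  finally show ?thesis .
qed

lemma D_component:
  assumes mn: "m + n = l" and mn': "m' + n' = Suc l"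
  shows "\<pi>' (Suc l) (m', n') \<cdot> D l \<cdot> \<iota>' l (m, n) =
    component (Suc (Suc (Suc l))) (d (Suc (Suc (Suc l)))) (m, Suc n) (m', Suc n')"
proof -
  have "\<pi>' (Suc l) (m', n') \<cdot> D l =
      \<pi> (Suc (Suc (Suc (Suc l)))) (m', Suc n') \<cdot> (d (Suc (Suc (Suc l))) \<cdot> j l)"
    using Comp_assoc[OF dj_Hom q_Hom proj'_Hom[OF mn']] proj_q[OF mn'] by (simp add: D_def)
  moreover have "m' + Suc n' + 2 = Suc (Suc (Suc (Suc l)))" using mn' by simp
  ultimately show ?thesis
    using Comp_assoc[OF inj'_Hom[OF mn] dj_Hom proj_Hom] Comp_assoc[OF inj'_Hom[OF mn] j_Hom d_Hom]
      j_inj[OF mn]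
    by (simp add: component_def)
qed

text \<open>The part of \<open>d\<close> that leads from the bottom row to the subcomplex.  It is the connecting map
  \<open>M \<rightarrow> S\<close>, a chain map up to sign, and in degree 0 the augmentation of the first resolution.\<close>

definition \<alpha> :: "nat \<Rightarrow> 'm" where
  "\<alpha> l = q l \<cdot> (d (Suc (Suc l)) \<cdot> \<iota> (Suc (Suc l)) (l, 0))"

lemma inj_0_Hom: "\<iota> (Suc (Suc l)) (l, 0) \<in> Hom C (J (l, 0)) (X (Suc (Suc l)))"
  by (rule inj_Hom) simp

lemma proj_0_Hom: "\<pi> (Suc (Suc l)) (l, 0) \<in> Hom C (X (Suc (Suc l))) (J (l, 0))"
  by (rule proj_Hom) simp

lemma di_Hom: "d (Suc (Suc l)) \<cdot> \<iota> (Suc (Suc l)) (l, 0) \<in> Hom C (J (l, 0)) (Y l)"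
  by (rule Comp_in_Hom[OF inj_0_Hom d_Hom])

lemma \<alpha>_Hom: "\<alpha> l \<in> Hom C (J (l, 0)) (S l)"
  unfolding \<alpha>_def by (rule Comp_in_Hom[OF di_Hom q_Hom])

lemma d_inj_0:
  "d (Suc (Suc l)) \<cdot> \<iota> (Suc (Suc l)) (l, 0) = j l \<cdot> \<alpha> l \<boxplus> \<iota> (Suc (Suc (Suc l))) (Suc l, 0) \<cdot> \<tau> l"
proof -
  have ja: "j l \<cdot> \<alpha> l \<in> Hom C (J (l, 0)) (Y l)" by (rule Comp_in_Hom[OF \<alpha>_Hom j_Hom])
  have it: "\<iota> (Suc (Suc (Suc l))) (Suc l, 0) \<cdot> \<tau> l \<in> Hom C (J (l, 0)) (Y l)"
    by (rule Comp_in_Hom[OF row inj_0_Hom])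
  show ?thesis
  proof (rule eq_on_projections[OF sum di_Hom Add_in_Hom[OF ja it]])
    fix i assume "i \<in> diagonal (Suc (Suc (Suc l)))"
    then obtain a b where i: "i = (a, b)" "a + b + 2 = Suc (Suc (Suc l))" by (cases i) auto
    let ?p = "\<pi> (Suc (Suc (Suc l))) (a, b)"
    note p = proj_Hom[OF i(2)]
    have "?p \<cdot> (j l \<cdot> \<alpha> l \<boxplus> \<iota> (Suc (Suc (Suc l))) (Suc l, 0) \<cdot> \<tau> l) =
        (?p \<cdot> j l) \<cdot> \<alpha> l \<boxplus> (?p \<cdot> \<iota> (Suc (Suc (Suc l))) (Suc l, 0)) \<cdot> \<tau> l"
      using Comp_Add_right[OF ja it p] Comp_assoc[OF \<alpha>_Hom j_Hom p] Comp_assoc[OF row inj_0_Hom p] by simp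
    also have "\<dots> = ?p \<cdot> (d (Suc (Suc l)) \<cdot> \<iota> (Suc (Suc l)) (l, 0))"
    proof (cases b)
      case 0
      then have a: "a = Suc l" using i(2) by simp
      have "?p \<cdot> \<iota> (Suc (Suc (Suc l))) (Suc l, 0) = Ide C (J (Suc l, 0))"
        using direct_sumD(6)[OF sum, of "(Suc l, 0)"] a 0 by simp
      moreover have "?p \<cdot> (d (Suc (Suc l)) \<cdot> \<iota> (Suc (Suc l)) (l, 0)) = \<tau> l"
        using triangularD(4)[OF d_triangular, of l "Suc (Suc l)"] a 0 by simp
      ultimately show ?thesis
        using a 0 proj_j_0 Comp_Zero_left[OF \<alpha>_Hom J_Obj] Comp_Ide_left[OF row] Add_Zero(2)[OF row] by simp
    next
      case (Suc b')
      then have ab: "a + b' = l" using i(2) by simp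
      have "?p \<cdot> \<iota> (Suc (Suc (Suc l))) (Suc l, 0) = Zero C (J (Suc l, 0)) (J (a, b))"
        using direct_sumD(7)[OF sum, of "(Suc l, 0)" _ "(a, b)"] i(2) Suc by simp
      moreover have "(?p \<cdot> j l) \<cdot> \<alpha> l = ?p \<cdot> (d (Suc (Suc l)) \<cdot> \<iota> (Suc (Suc l)) (l, 0))"
        using proj_j[OF ab] proj_q[OF ab] Comp_assoc[OF di_Hom q_Hom proj'_Hom[OF ab]] Suc
        by (simp add: \<alpha>_def)
      ultimately show ?thesis
        using Comp_Zero_left[OF row J_Obj] Add_Zero(1)[OF Comp_in_Hom[OF di_Hom p]] by simp
    qed
    finally show "\<pi> (Suc (Suc (Suc l))) i \<cdot> (d (Suc (Suc l)) \<cdot> \<iota> (Suc (Suc l)) (l, 0)) =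
        \<pi> (Suc (Suc (Suc l))) i \<cdot> (j l \<cdot> \<alpha> l \<boxplus> \<iota> (Suc (Suc (Suc l))) (Suc l, 0) \<cdot> \<tau> l)"
      using i(1) by simp
  qed
qed

lemma D_\<alpha>: "D l \<cdot> \<alpha> l \<boxplus> \<alpha> (Suc l) \<cdot> \<tau> l = Zero C (J (l, 0)) (S (Suc l))"
proof -
  let ?d = "d (Suc (Suc (Suc l)))" and ?i = "\<iota> (Suc (Suc (Suc l))) (Suc l, 0)"
  have qd: "q (Suc l) \<cdot> ?d \<in> Hom C (Y l) (S (Suc l))" by (rule Comp_in_Hom[OF d_Hom q_Hom])
  have "q (Suc l) \<cdot> ?d \<cdot> (d (Suc (Suc l)) \<cdot> \<iota> (Suc (Suc l)) (l, 0)) =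
      q (Suc l) \<cdot> (?d \<cdot> d (Suc (Suc l)) \<cdot> \<iota> (Suc (Suc l)) (l, 0))"
    using Comp_assoc[OF di_Hom d_Hom q_Hom] Comp_assoc[OF inj_0_Hom d_Hom d_Hom] by simp
  also have "\<dots> = Zero C (J (l, 0)) (S (Suc l))"
    using d_square Comp_Zero_left[OF inj_0_Hom X_Obj] Comp_Zero_right[OF q_Hom J_Obj] by simp
  finally have "q (Suc l) \<cdot> ?d \<cdot> (j l \<cdot> \<alpha> l \<boxplus> ?i \<cdot> \<tau> l) = Zero C (J (l, 0)) (S (Suc l))"
    by (simp add: d_inj_0)
  moreover have "q (Suc l) \<cdot> ?d \<cdot> (j l \<cdot> \<alpha> l \<boxplus> ?i \<cdot> \<tau> l) =
      q (Suc l) \<cdot> ?d \<cdot> (j l \<cdot> \<alpha> l) \<boxplus> q (Suc l) \<cdot> ?d \<cdot> (?i \<cdot> \<tau> l)"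
    by (rule Comp_Add_right[OF Comp_in_Hom[OF \<alpha>_Hom j_Hom] Comp_in_Hom[OF row inj_0_Hom] qd])
  moreover have "q (Suc l) \<cdot> ?d \<cdot> (j l \<cdot> \<alpha> l) = D l \<cdot> \<alpha> l"
    using Comp_assoc[OF \<alpha>_Hom j_Hom qd] Comp_assoc[OF j_Hom d_Hom q_Hom] by (simp add: D_def)
  moreover have "q (Suc l) \<cdot> ?d \<cdot> (?i \<cdot> \<tau> l) = \<alpha> (Suc l) \<cdot> \<tau> l"
    using Comp_assoc[OF row inj_0_Hom qd] Comp_assoc[OF inj_0_Hom d_Hom q_Hom] by (simp add: \<alpha>_def)
  ultimately show ?thesis by simp
qed

text \<open>
  The arrow \<open>h\<close> prescribes the values on the complement \<open>M\<^sup>l\<^sup>+\<^sup>1\<close> of \<open>S\<^sup>l\<close>.  The condition on it says that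
  \<open>f\<close> and \<open>h\<close> together annihilate \<open>d\<close> on \<open>M\<^sup>l\<close>, while the condition on \<open>f\<close> takes care of the rest.  So
  exactness of the augmented complex applies, and the resulting extension is restricted to \<open>S\<close>.
\<close>

lemma extension_over_D:
  assumes Q: "is_injective C Q" and f: "f \<in> Hom C (S l) Q"
    and fD: "\<And>k. l = Suc k \<Longrightarrow> f \<cdot> D k = Zero C (S k) Q"
    and h: "h \<in> Hom C (J (Suc l, 0)) Q" "h \<cdot> \<tau> l \<boxplus> f \<cdot> \<alpha> l = Zero C (J (l, 0)) Q"
  shows "\<exists>x \<in> Hom C (S (Suc l)) Q. x \<cdot> D l = f"
proof -
  have Qo: "Q \<in> Obj C" using Q by (simp add: is_injective_def)
  let ?n = "Suc (Suc l)" and ?p = "\<pi> (Suc (Suc (Suc l))) (Suc l, 0)"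
  define F where "F = h \<cdot> ?p \<boxplus> f \<cdot> q l"
  note p = proj_0_Hom[of "Suc l"]
  have hp: "h \<cdot> ?p \<in> Hom C (Y l) Q" by (rule Comp_in_Hom[OF p h(1)])
  have fq: "f \<cdot> q l \<in> Hom C (Y l) Q" by (rule Comp_in_Hom[OF q_Hom f])
  have F: "F \<in> Hom C (Y l) Q" unfolding F_def by (rule Add_in_Hom[OF hp fq])
  have Fx: "F \<cdot> x = h \<cdot> (?p \<cdot> x) \<boxplus> f \<cdot> (q l \<cdot> x)" if x: "x \<in> Hom C W (Y l)" for W x
    using Comp_Add_left[OF x hp fq] Comp_assoc[OF x p h(1)] Comp_assoc[OF x q_Hom f]
    by (simp add: F_def)
  have "F \<cdot> d ?n = Zero C (X ?n) Q"
  proof (rule eq_on_summands[OF sum Comp_in_Hom[OF d_Hom F] Zero_in_Hom[OF X_Obj Qo]])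
    fix i assume "i \<in> diagonal ?n"
    then obtain a b where i: "i = (a, b)" "a + b + 2 = ?n" by (cases i) auto
    note iH = inj_Hom[OF i(2)]
    have "F \<cdot> (d ?n \<cdot> \<iota> ?n (a, b)) = Zero C (J (a, b)) Q"
    proof (cases b)
      case 0
      then have a: "a = l" using i(2) by simp
      have "?p \<cdot> (d ?n \<cdot> \<iota> ?n (l, 0)) = \<tau> l"
        using triangularD(4)[OF d_triangular, of l ?n] by simp
      then show ?thesis using Fx[OF di_Hom] h(2) a 0 by (simp add: \<alpha>_def)
    next
      case (Suc b')
      then obtain k where k: "l = Suc k" "a + b' = k" using i(2) by (cases l) auto
      have ji: "\<iota> ?n (a, b) = j k \<cdot> \<iota>' k (a, b')" using j_inj[OF k(2)] k(1) Suc by simp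
      have "F \<cdot> (d ?n \<cdot> j k) = h \<cdot> (?p \<cdot> (d ?n \<cdot> j k)) \<boxplus> f \<cdot> D k"
        using Fx[of "d ?n \<cdot> j k"] dj_Hom[of k] k(1) by (simp add: D_def)
      also have "\<dots> = Zero C (S k) Q"
        using proj_d_j_0[of k] k(1) Comp_Zero_right[OF h(1) S_Obj] fD[OF k(1)]
          Add_Zero(1)[OF Zero_in_Hom[OF S_Obj Qo]] by simp
      finally have 0: "F \<cdot> (d ?n \<cdot> j k) = Zero C (S k) Q" .
      have dj: "d ?n \<cdot> j k \<in> Hom C (S k) (Y l)" using dj_Hom[of k] k(1) by simp
      have jk: "j k \<in> Hom C (S k) (X ?n)" using j_Hom[of k] k(1) by simp
      show ?thesis
        using 0 Comp_assoc[OF inj'_Hom[OF k(2)] dj F] Comp_assoc[OF inj'_Hom[OF k(2)] jk d_Hom] ji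
          Comp_Zero_left[OF inj'_Hom[OF k(2)] Qo] Suc by simp
    qed
    then show "F \<cdot> d ?n \<cdot> \<iota> ?n i = Zero C (X ?n) Q \<cdot> \<iota> ?n i"
      using Comp_assoc[OF iH d_Hom F] Comp_Zero_left[OF iH Qo] i(1) by simp
  qed
  \<comment> \<open>no column has index \<open>l + 2\<close> or more in this degree, so no vanishing is required of \<open>F\<close>\<close>
  then obtain x where x: "x \<in> Hom C (Y (Suc l)) Q" "x \<cdot> d (Suc ?n) = F"
    using filtered_exact[OF d_triangular d_triangular d_square Q F, of "Suc (Suc l)"] by auto
  have xj: "x \<cdot> j (Suc l) \<in> Hom C (S (Suc l)) Q" by (rule Comp_in_Hom[OF j_Hom x(1)])
  have "x \<cdot> j (Suc l) \<cdot> D l = x \<cdot> (d (Suc ?n) \<cdot> j l)"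
    using Comp_assoc[OF D_Hom j_Hom x(1)] d_j by simp
  also have "\<dots> = F \<cdot> j l" using Comp_assoc[OF j_Hom d_Hom x(1)] x(2) by simp
  also have "\<dots> = f"
    using Fx[OF j_Hom] proj_j_0 q_j Comp_Zero_right[OF h(1) S_Obj] Comp_Ide_right[OF f] Add_Zero(2)[OF f]
    by simp
  finally show ?thesis using xj by blast
qed

lemma negative_extension:
  assumes ex: "hom_exact C W (J (l, 0)) (J (Suc l, 0)) u (\<tau> l)" and u: "u \<in> Hom C W (J (l, 0))"
    and Q: "is_injective C Q" and \<phi>: "\<phi> \<in> Hom C (J (l, 0)) Q" "\<phi> \<cdot> u = Zero C W Q"
  shows "\<exists>h \<in> Hom C (J (Suc l, 0)) Q. h \<cdot> \<tau> l \<boxplus> \<phi> = Zero C (J (l, 0)) Q"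
proof -
  have Qo: "Q \<in> Obj C" using Q by (simp add: is_injective_def)
  obtain \<psi> where \<psi>: "\<psi> \<in> Hom C (J (l, 0)) Q" "\<psi> \<boxplus> \<phi> = Zero C (J (l, 0)) Q"
    using difference_exists[OF Zero_in_Hom[OF J_Obj Qo] \<phi>(1)] by blast
  have "\<psi> \<cdot> u = Zero C W Q"
    using Comp_Add_left[OF u \<psi>(1) \<phi>(1)] \<psi>(2) \<phi>(2) Comp_Zero_left[OF u Qo]
      Add_Zero(1)[OF Comp_in_Hom[OF u \<psi>(1)]] by simp
  then obtain h where "h \<in> Hom C (J (Suc l, 0)) Q" "h \<cdot> \<tau> l = \<psi>"
    using ex \<psi>(1) Q unfolding hom_exact_def by blast
  then show ?thesis using \<psi>(2) by blast
qed

text \<open>If \<open>f\<close> annihilates \<open>D\<close>, then \<open>f \<cdot> \<alpha>\<close> annihilates \<open>\<tau>\<close> because \<open>\<alpha>\<close> is a chain map up to sign;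
  exactness of \<open>M\<close> then yields the arrow \<open>h\<close> that \<open>extension_over_D\<close> asks for.\<close>

lemma D_exact: "hom_exact C (S l) (S (Suc l)) (S (Suc (Suc l))) (D l) (D (Suc l))"
  unfolding hom_exact_def
proof (intro allI ballI impI)
  fix Q f assume f: "f \<in> Hom C (S (Suc l)) Q" and Q: "is_injective C Q" and 0: "f \<cdot> D l = Zero C (S l) Q"
  have Qo: "Q \<in> Obj C" using Q by (simp add: is_injective_def)
  have fa: "f \<cdot> \<alpha> (Suc l) \<in> Hom C (J (Suc l, 0)) Q" by (rule Comp_in_Hom[OF \<alpha>_Hom f])
  have Da: "D l \<cdot> \<alpha> l \<in> Hom C (J (l, 0)) (S (Suc l))" by (rule Comp_in_Hom[OF \<alpha>_Hom D_Hom])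
  have at: "\<alpha> (Suc l) \<cdot> \<tau> l \<in> Hom C (J (l, 0)) (S (Suc l))" by (rule Comp_in_Hom[OF row \<alpha>_Hom])
  have "Zero C (J (l, 0)) Q = f \<cdot> (D l \<cdot> \<alpha> l \<boxplus> \<alpha> (Suc l) \<cdot> \<tau> l)"
    using D_\<alpha> Comp_Zero_right[OF f J_Obj] by simp
  also have "\<dots> = f \<cdot> D l \<cdot> \<alpha> l \<boxplus> f \<cdot> \<alpha> (Suc l) \<cdot> \<tau> l"
    using Comp_Add_right[OF Da at f] Comp_assoc[OF \<alpha>_Hom D_Hom f] Comp_assoc[OF row \<alpha>_Hom f] by simp
  also have "\<dots> = f \<cdot> \<alpha> (Suc l) \<cdot> \<tau> l"
    using 0 Comp_Zero_left[OF \<alpha>_Hom Qo] Add_Zero(2)[OF Comp_in_Hom[OF row fa]] by simp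
  finally obtain h where "h \<in> Hom C (J (Suc (Suc l), 0)) Q"
      "h \<cdot> \<tau> (Suc l) \<boxplus> f \<cdot> \<alpha> (Suc l) = Zero C (J (Suc l, 0)) Q"
    using negative_extension[OF row_exact_Suc row Q fa] by auto
  then show "\<exists>x \<in> Hom C (S (Suc (Suc l))) Q. x \<cdot> D (Suc l) = f"
    using extension_over_D[OF Q f] 0 by blast
qed

lemma D_exact_0: "hom_exact C A (S 0) (S (Suc 0)) (\<alpha> 0 \<cdot> \<kappa>) (D 0)"
  unfolding hom_exact_def
proof (intro allI ballI impI)
  fix Q f assume f: "f \<in> Hom C (S 0) Q" and Q: "is_injective C Q" and 0: "f \<cdot> (\<alpha> 0 \<cdot> \<kappa>) = Zero C A Q"
  have fa: "f \<cdot> \<alpha> 0 \<in> Hom C (J (0, 0)) Q" by (rule Comp_in_Hom[OF \<alpha>_Hom f])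
  have "f \<cdot> \<alpha> 0 \<cdot> \<kappa> = Zero C A Q" using 0 Comp_assoc[OF augmentation(1) \<alpha>_Hom f] by simp
  then obtain h where "h \<in> Hom C (J (Suc 0, 0)) Q" "h \<cdot> \<tau> 0 \<boxplus> f \<cdot> \<alpha> 0 = Zero C (J (0, 0)) Q"
    using negative_extension[OF _ augmentation(1) Q fa] row_exact_0 by auto
  then show "\<exists>x \<in> Hom C (S (Suc 0)) Q. x \<cdot> D 0 = f"
    using extension_over_D[OF Q f] by blast
qed

lemma D_augmentation: "D 0 \<cdot> (\<alpha> 0 \<cdot> \<kappa>) = Zero C A (S 1)"
proof -
  note k = augmentation(1)
  have A: "A \<in> Obj C" using Hom_objects[OF k] by simp
  have Da: "D 0 \<cdot> \<alpha> 0 \<in> Hom C (J (0, 0)) (S (Suc 0))" by (rule Comp_in_Hom[OF \<alpha>_Hom D_Hom])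
  have at: "\<alpha> (Suc 0) \<cdot> \<tau> 0 \<in> Hom C (J (0, 0)) (S (Suc 0))" by (rule Comp_in_Hom[OF row \<alpha>_Hom])
  have "Zero C A (S (Suc 0)) = (D 0 \<cdot> \<alpha> 0 \<boxplus> \<alpha> (Suc 0) \<cdot> \<tau> 0) \<cdot> \<kappa>"
    using D_\<alpha> Comp_Zero_left[OF k S_Obj] by simp
  also have "\<dots> = D 0 \<cdot> \<alpha> 0 \<cdot> \<kappa> \<boxplus> \<alpha> (Suc 0) \<cdot> (\<tau> 0 \<cdot> \<kappa>)"
    using Comp_Add_left[OF k Da at] Comp_assoc[OF k row \<alpha>_Hom] by simp
  also have "\<dots> = D 0 \<cdot> \<alpha> 0 \<cdot> \<kappa>"
    using augmentation(2) Comp_Zero_right[OF \<alpha>_Hom A] Add_Zero(1)[OF Comp_in_Hom[OF k Da]] by simp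
  finally show ?thesis using Comp_assoc[OF k \<alpha>_Hom D_Hom] by simp
qed

lemma \<alpha>_0: "\<alpha> 0 = \<iota>' 0 (0, 0) \<cdot> \<epsilon> 0 0"
proof -
  have i0: "\<iota>' 0 (0, 0) \<in> Hom C (J (0, Suc 0)) (S 0)" by (rule inj'_Hom) simp
  show ?thesis
  proof (rule eq_on_projections[OF S_sum \<alpha>_Hom Comp_in_Hom[OF column i0]])
    fix i assume "i \<in> {(m, n). m + n = (0::nat)}"
    then have i: "i = (0, 0)" by auto
    have p: "\<pi>' 0 (0, 0) \<in> Hom C (S 0) (J (0, Suc 0))" by (rule proj'_Hom) simp
    have "\<pi>' 0 (0, 0) \<cdot> \<iota>' 0 (0, 0) = Ide C (J (0, Suc 0))"
      using direct_sumD(6)[OF S_sum, of "(0, 0)" 0] by simp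
    then have "\<pi>' 0 (0, 0) \<cdot> (\<iota>' 0 (0, 0) \<cdot> \<epsilon> 0 0) = \<epsilon> 0 0"
      using Comp_assoc[OF column i0 p] Comp_Ide_left[OF column] by simp
    moreover have "\<pi>' 0 (0, 0) \<cdot> \<alpha> 0 = \<epsilon> 0 0"
      using Comp_assoc[OF di_Hom q_Hom p] proj_q[of 0 0 0]
        triangularD(3)[OF d_triangular, of 0 0 "Suc (Suc 0)"] by (simp add: \<alpha>_def)
    ultimately show "\<pi>' 0 i \<cdot> \<alpha> 0 = \<pi>' 0 i \<cdot> (\<iota>' 0 (0, 0) \<cdot> \<epsilon> 0 0)" using i by simp
  qed
qed

lemma \<alpha>_0_mono:
  assumes "is_mono C (\<epsilon> 0 0)"
  shows "is_mono C (\<alpha> 0)"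
proof -
  have i0: "\<iota>' 0 (0, 0) \<in> Hom C (J (0, Suc 0)) (S 0)" and p: "\<pi>' 0 (0, 0) \<in> Hom C (S 0) (J (0, Suc 0))"
    by (rule inj'_Hom proj'_Hom, simp)+
  have pi: "\<pi>' 0 (0, 0) \<cdot> \<iota>' 0 (0, 0) = Ide C (J (0, Suc 0))"
    using direct_sumD(6)[OF S_sum, of "(0, 0)" 0] by simp
  have "is_mono C (\<iota>' 0 (0, 0))"
  proof (rule is_monoI[OF i0])
    fix W x assume x: "x \<in> Hom C W (J (0, Suc 0))" and 0: "\<iota>' 0 (0, 0) \<cdot> x = Zero C W (S 0)"
    show "x = Zero C W (J (0, Suc 0))"
      using Comp_assoc[OF x i0 p] pi 0 Comp_Ide_left[OF x] Comp_Zero_right[OF p] Hom_objects[OF x] by simp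
  qed
  then show ?thesis unfolding \<alpha>_0 using Comp_mono[OF column assms i0] by simp
qed

lemma D_injective_resolution:
  assumes en: "enough_injectives C" and mono: "is_mono C (\<epsilon> 0 0)" "is_mono C \<kappa>"
  shows "injective_resolution C A S D"
proof -
  have cc: "cochain_complex C S D" using D_Hom D_square by (simp add: cochain_complex_def)
  have ak: "\<alpha> 0 \<cdot> \<kappa> \<in> Hom C A (S 0)" by (rule Comp_in_Hom[OF augmentation(1) \<alpha>_Hom])
  have "is_kernel C (D 0) A (\<alpha> 0 \<cdot> \<kappa>)"
    using hom_exact_imp_kernel[OF en ak Comp_mono[OF augmentation(1) mono(2) \<alpha>_Hom \<alpha>_0_mono[OF mono(1)]] D_Hom _ D_exact_0]
      D_augmentation by simp
  moreover have "is_injective C (S l)" for l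
    by (rule direct_sum_injective[OF S_sum]) (auto intro: injective_above)
  moreover have "cohomology_vanishes C S D k" if "k \<ge> 1" for k
    using hom_exact_imp_vanishing[OF en cc D_exact] that by (cases k) auto
  ultimately show ?thesis unfolding injective_resolution_def using cc by auto
qed

end

section \<open>The total injective resolution\<close>

theorem mainTheorem1:
  fixes C :: "('o, 'm) preadditive_category"
    and M :: "nat \<Rightarrow> 'o" and \<tau> :: "nat \<Rightarrow> 'm"
    and A :: 'o and \<kappa> :: 'm
    and I :: "nat \<Rightarrow> nat \<Rightarrow> 'o" and \<delta> :: "nat \<Rightarrow> nat \<Rightarrow> 'm"
  assumes "abelian_category C"
    and "enough_injectives C"
    and "cochain_complex C M \<tau>"
    and "\<forall>k \<ge> 1. cohomology_vanishes C M \<tau> k"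
    and "is_kernel C (\<tau> 0) A \<kappa>"
    and "\<forall>k. injective_resolution C (M k) (I k) (\<delta> k)"
  shows "\<exists>E :: nat \<Rightarrow> nat \<Rightarrow> nat \<Rightarrow> 'm.
    (\<forall>k t i. i \<le> t \<longrightarrow> E k t i \<in> Hom C (I k t) (I (k + i + 1) (t - i))) \<and>
    (\<forall>S \<iota> \<pi>.
      (\<forall>l. is_direct_sum C {(m, n). m + n = l} (\<lambda>(m, n). I m n) (S l) (\<iota> l) (\<pi> l)) \<longrightarrow>
      (\<exists>d. (\<forall>l. d l \<in> Hom C (S l) (S (l + 1)) \<and>
              (\<forall>m n m' n'. m + n = l \<longrightarrow> m' + n' = l + 1 \<longrightarrow>
                 \<pi> (l + 1) (m', n') \<cdot>\<^bsub>C\<^esub> d l \<cdot>\<^bsub>C\<^esub> \<iota> l (m, n)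
                   = total_component C I \<delta> E (m, n) (m', n'))) \<and>
           injective_resolution C A S d))"
proof -
  interpret abelian_category C by (rule assms(1))
  note en = assms(2)
  have res: "cochain_complex C (I k) (\<delta> k)" "\<And>n. is_injective C (I k n)"
      "\<exists>\<eta>. is_kernel C (\<delta> k 0) (M k) \<eta>" "\<And>n. cohomology_vanishes C (I k) (\<delta> k) (Suc n)" for k
    using assms(6) by (simp_all add: injective_resolution_def)
  obtain \<eta> where \<eta>: "\<And>k. is_kernel C (\<delta> k 0) (M k) (\<eta> k)" using res(3) by metis
  have \<delta>: "\<delta> k n \<in> Hom C (I k n) (I k (Suc n))"
      "\<delta> k (Suc n) \<cdot>\<^bsub>C\<^esub> \<delta> k n = Zero C (I k n) (I k (Suc (Suc n)))" for k n
    using res(1)[of k] by (simp_all add: cochain_complex_def)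
  have \<tau>: "\<tau> k \<in> Hom C (M k) (M (Suc k))"
      "\<tau> (Suc k) \<cdot>\<^bsub>C\<^esub> \<tau> k = Zero C (M k) (M (Suc (Suc k)))" for k
    using assms(3) by (simp_all add: cochain_complex_def)
  have \<eta>k: "\<eta> k \<in> Hom C (M k) (I k 0)" "\<delta> k 0 \<cdot>\<^bsub>C\<^esub> \<eta> k = Zero C (M k) (I k (Suc 0))" for k
    using kernelD[OF \<eta> \<delta>(1)] by auto
  define J where "J = (\<lambda>(m, p). case p of 0 \<Rightarrow> M m | Suc n \<Rightarrow> I m n)"
  define \<epsilon> where "\<epsilon> = (\<lambda>m p. case p of 0 \<Rightarrow> \<eta> m | Suc n \<Rightarrow> \<delta> m n)"
  have J [simp]: "J (m, 0) = M m" "J (m, Suc n) = I m n" for m n by (simp_all add: J_def)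
  have \<epsilon> [simp]: "\<epsilon> m 0 = \<eta> m" "\<epsilon> m (Suc n) = \<delta> m n" for m n by (simp_all add: \<epsilon>_def)
  have J_Obj: "J i \<in> Obj C" for i
  proof -
    obtain m p where "i = (m, p)" by (cases i)
    then show ?thesis using Hom_objects[OF \<tau>(1)[of m]] Hom_objects[OF \<delta>(1)[of m]] by (cases p) auto
  qed
  have fin: "finite (diagonal l)" for l
    by (rule finite_subset[of _ "{..l} \<times> {..l}"]) (auto simp: diagonal_def)
  have "\<forall>l. \<exists>X \<iota> \<pi>. is_direct_sum C (diagonal l) J X \<iota> \<pi>"
    using direct_sum_exists[where X = J, OF fin J_Obj] by blast
  then obtain X \<iota>X \<pi>X where X: "\<And>l. is_direct_sum C (diagonal l) J (X l) (\<iota>X l) (\<pi>X l)" by metis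
  interpret R: resolved_complex C J \<epsilon> \<tau> X \<iota>X \<pi>X
  proof (unfold_locales, goal_cases)
    case (1 m)
    then show ?case using \<tau>(1) by simp
  next
    case (2 m)
    then show ?case using \<tau>(2) by simp
  next
    case (3 m p)
    then show ?case using \<delta>(1) \<eta>k(1) by (cases p) simp_all
  next
    case (4 m p)
    then show ?case using \<delta>(2) \<eta>k(2) by (cases p) simp_all
  next
    case (5 Q h m)
    then show ?case using injective_extension[OF 5(1) kernel_is_mono[OF \<eta>] \<eta>k(1)] by simp
  next
    case (6 m p)
    then show ?case
      using kernel_imp_hom_exact[OF \<delta>(1) \<eta>] vanishing_imp_hom_exact[OF res(1) res(4)]
      by (cases p) simp_all
  next
    case (7 m p)
    then show ?case using res(2) by simp
  next
    case (8 l)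
    then show ?case by (rule X)
  qed
  obtain d where d: "\<And>l. R.triangular l (d l)"
      "\<And>l. d (Suc l) \<cdot>\<^bsub>C\<^esub> d l = Zero C (X l) (X (Suc (Suc l)))"
    using R.total_differential_exists by blast
  \<comment> \<open>The rows of the augmented array are shifted by one and its degrees by three.\<close>
  define E where "E k t i = R.component (Suc (Suc (Suc (k + t)))) (d (Suc (Suc (Suc (k + t)))))
      (k, Suc t) (k + i + 1, Suc (t - i))" for k t i
  have E: "E k t i \<in> Hom C (I k t) (I (k + i + 1) (t - i))" if i: "i \<le> t" for k t i
  proof -
    let ?l = "Suc (Suc (Suc (k + t)))"
    have "\<iota>X ?l (k, Suc t) \<in> Hom C (I k t) (X ?l)" using R.inj_Hom[of k "Suc t"] by simp
    moreover have "\<pi>X (Suc ?l) (k + i + 1, Suc (t - i)) \<in> Hom C (X (Suc ?l)) (I (k + i + 1) (t - i))"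
      using R.proj_Hom[of "k + i + 1" "Suc (t - i)" "Suc ?l"] i by simp
    ultimately show ?thesis
      using Comp_in_Hom[OF Comp_in_Hom] R.triangularD(1)[OF d(1)] unfolding E_def R.component_def by metis
  qed
  have main: "\<exists>D. (\<forall>l. D l \<in> Hom C (S l) (S (l + 1)) \<and>
              (\<forall>m n m' n'. m + n = l \<longrightarrow> m' + n' = l + 1 \<longrightarrow>
                 \<pi> (l + 1) (m', n') \<cdot>\<^bsub>C\<^esub> D l \<cdot>\<^bsub>C\<^esub> \<iota> l (m, n)
                   = total_component C I \<delta> E (m, n) (m', n'))) \<and>
           injective_resolution C A S D"
    if S: "\<forall>l. is_direct_sum C {(m, n). m + n = l} (\<lambda>(m, n). I m n) (S l) (\<iota> l) (\<pi> l)" for S \<iota> \<pi>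
  proof -
    have S': "is_direct_sum C {(m, n). m + n = l} (\<lambda>(m, n). J (m, Suc n)) (S l) (\<iota> l) (\<pi> l)" for l
      using S by simp
    obtain j q where jq: "\<And>l. j l \<in> Hom C (S l) (X (Suc (Suc (Suc l))))"
        "\<And>l. q l \<in> Hom C (X (Suc (Suc (Suc l)))) (S l)"
        "\<And>l m n. m + n = l \<Longrightarrow> j l \<cdot>\<^bsub>C\<^esub> \<iota> l (m, n) = \<iota>X (Suc (Suc (Suc l))) (m, Suc n)"
        "\<And>l m n. m + n = l \<Longrightarrow> q l \<cdot>\<^bsub>C\<^esub> \<iota>X (Suc (Suc (Suc l))) (m, Suc n) = \<iota> l (m, n)"
        "\<And>l. q l \<cdot>\<^bsub>C\<^esub> \<iota>X (Suc (Suc (Suc l))) (Suc l, 0) = Zero C (J (Suc l, 0)) (S l)"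
      using R.inclusion_and_retraction[OF S'] by metis
    have \<kappa>: "\<kappa> \<in> Hom C A (M 0)" "\<tau> 0 \<cdot>\<^bsub>C\<^esub> \<kappa> = Zero C A (M 1)"
      using kernelD[OF assms(5) \<tau>(1)] by auto
    interpret T: resolved_subcomplex C J \<epsilon> \<tau> X \<iota>X \<pi>X d A \<kappa> S \<iota> \<pi> j q
    proof (unfold_locales, goal_cases)
      case 5
      then show ?case using kernel_imp_hom_exact[OF \<tau>(1) assms(5)] by simp
    next
      case (6 l)
      then show ?case using vanishing_imp_hom_exact[OF assms(3)] assms(4) by simp
    qed (use d \<kappa> S' jq in \<open>simp_all\<close>)
    have "\<pi> (Suc l) (m', n') \<cdot>\<^bsub>C\<^esub> T.D l \<cdot>\<^bsub>C\<^esub> \<iota> l (m, n) = total_component C I \<delta> E (m, n) (m', n')"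
      if mn: "m + n = l" "m' + n' = Suc l" for l m n m' n'
    proof -
      let ?l = "Suc (Suc (Suc l))"
      have i: "m + Suc n + 2 = ?l" "m' + Suc n' + 2 = Suc ?l" using mn by simp_all
      consider "m' < m" | "m' = m" | "m < m'" by linarith
      then show ?thesis
      proof cases
        case 1
        then show ?thesis
          using T.D_component[OF mn] R.triangularD(2)[OF d(1) i]
          by (simp add: R.component_def total_component_def)
      next
        case 2
        then have "n' = Suc n" using mn by simp
        then show ?thesis
          using 2 T.D_component[OF mn] R.triangularD(3)[OF d(1) i(1)]
          by (simp add: R.component_def total_component_def)
      next
        case 3
        then have "m' = m + (m' - m - 1) + 1" "n' = n - (m' - m - 1)" using mn by simp_all
        then show ?thesis
          using 3 T.D_component[OF mn] mn by (simp add: E_def total_component_def)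
      qed
    qed
    moreover have "injective_resolution C A S T.D"
      using T.D_injective_resolution[OF en] kernel_is_mono[OF \<eta>] kernel_is_mono[OF assms(5)] by simp
    ultimately show ?thesis using T.D_Hom by (intro exI[of _ T.D]) simp
  qed
  show ?thesis using E main by (intro exI[of _ E] conjI allI impI) blast+
qed

end
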